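(* Let $\Bbbk$ be a unital commutative ring, $A$ a $\Bbbk$-free cocommutative Hopf $\Bbbk$-algebra with antipode $S$, $V,M$ two $\Bbbk$-free $A$-modules, and $\kappa\in\operatorname{Hom}_\Bbbk(V\wedge V,M)$. Suppose $(B,\mu_B,1_B)$ is an associative $\Bbbk$-algebra containing $A$ and $M$, in which the relations $m\cdot a=\mu_B(\tau^{op}(m\otimes a))$ hold for all $m\in M$, $a\in A$. The following are equivalent in $B$: (1) $\kappa$ is $A$-equivariant: $a(\kappa(v,v'))=\sum\kappa(a_{(1)}(v),a_{(2)}(v'))$ for all $a\in A$, $v,v'\in V$. (2) $\kappa$ satisfies the Yetter--Drinfeld condition: $$\tau^{op}\Big(\sum\kappa(a_{(1)}(v),v')\,a_{(2)}\Big)=\sum a_{(1)}\,\kappa(v,S(a_{(2)})(v'))\qquad\forall a\in A,\ v,v'\in V.$$ (3) $\kappa$ is $A$-compatible: $a\,\kappa(v,v')=\sum\kappa(a_{(1)}(v),a_{(2)}(v'))\,a_{(3)}$ for all $a\in A$, $v,v'\in V$. (4) $\kappa(v,v')\,a=\sum a_{(1)}\,\kappa(S(a_{(2)})(v),S(a_{(3)})(v'))$ for all $a\in A$, $v,v'\in V$. If $\kappa$ also satisfies $\kappa(a(v),v')=\kappa(v,S(a)(v'))$ for all $v,v'\in V$, $a\in A$, then these are also equivalent to: (5) $\operatorname{im}\kappa$ commutes in $B$ with all of $A$.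
   Context: Sweedler notation: $\Delta(a)=\sum a_{(1)}\otimes a_{(2)}$, and iterates. $a(v)$, $a(m)$ denote the module actions of $A$ on $V$, $M$. $V\wedge V\subset V\otimes V$ is the span of the $v\wedge v'=v\otimes v'-v'\otimes v$; $\kappa(v,v')=\kappa(v\wedge v')$. The map $\tau^{op}:M\otimes A\to A\otimes M$ is $m\otimes a\mapsto\sum a_{(1)}\otimes S(a_{(2)})(m)$. "$B$ contains $A$ and $M$" means that $A$ is a unital subalgebra of $B$ and $M$ is a $\Bbbk$-submodule of $B$. All displayed identities are identities in $B$, with products taken in $B$; in (2) the left side is $\mu_B$ applied to $\tau^{op}\big(\sum\kappa(a_{(1)}(v),v')\otimes a_{(2)}\big)$. *)

theory Defs
  imports "HOL-Algebra.Module" "HOL-Algebra.Subrings"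
begin

section \<open>Linear maps, spans, free modules\<close>

definition linear_maps ::
    "('k, 'r) ring_scheme \<Rightarrow> ('k, 'x, 'p) module_scheme \<Rightarrow> ('k, 'y, 'q) module_scheme \<Rightarrow> ('x \<Rightarrow> 'y) set"
  where "linear_maps R X Y =
    {f. f \<in> carrier X \<rightarrow> carrier Y \<and>
        (\<forall>x\<in>carrier X. \<forall>x'\<in>carrier X. f (x \<oplus>\<^bsub>X\<^esub> x') = f x \<oplus>\<^bsub>Y\<^esub> f x') \<and>
        (\<forall>r\<in>carrier R. \<forall>x\<in>carrier X. f (r \<odot>\<^bsub>X\<^esub> x) = r \<odot>\<^bsub>Y\<^esub> f x)}"

definition submodule_span ::
    "('k, 'r) ring_scheme \<Rightarrow> ('k, 'x, 'p) module_scheme \<Rightarrow> 'x set \<Rightarrow> 'x set"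
  where "submodule_span R X E = \<Inter>{H. submodule H R X \<and> E \<subseteq> H}"

definition module_basis ::
    "('k, 'r) ring_scheme \<Rightarrow> ('k, 'x, 'p) module_scheme \<Rightarrow> 'x set \<Rightarrow> bool"
  where "module_basis R X E \<longleftrightarrow> E \<subseteq> carrier X \<and>
    (\<forall>x\<in>carrier X. \<exists>!c. range c \<subseteq> carrier R \<and>
        finite {e. c e \<noteq> \<zero>\<^bsub>R\<^esub>} \<and> {e. c e \<noteq> \<zero>\<^bsub>R\<^esub>} \<subseteq> E \<and>
        x = (\<Oplus>\<^bsub>X\<^esub>e\<in>{e. c e \<noteq> \<zero>\<^bsub>R\<^esub>}. c e \<odot>\<^bsub>X\<^esub> e))"

definition free_module :: "('k, 'r) ring_scheme \<Rightarrow> ('k, 'x, 'p) module_scheme \<Rightarrow> bool"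
  where "free_module R X \<longleftrightarrow> module R X \<and> (\<exists>E. module_basis R X E)"


section \<open>Tensor products\<close>

text \<open>A list \<open>[(x\<^sub>1, y\<^sub>1), \<dots>, (x\<^sub>n, y\<^sub>n)]\<close> over \<open>X \<times> Y\<close> stands for the formal sum
  \<open>x\<^sub>1 \<otimes> y\<^sub>1 + \<dots> + x\<^sub>n \<otimes> y\<^sub>n\<close>. The tensor product over \<open>R\<close> is the set of formal sums modulo the
  least congruence making concatenation commutative and \<open>\<otimes>\<close> bilinear; scalars are absorbed into
  the factors.\<close>

inductive_set tensor_rel ::
    "('k, 'r) ring_scheme \<Rightarrow> ('k, 'x, 'p) module_scheme \<Rightarrow> ('k, 'y, 'q) module_scheme
      \<Rightarrow> (('x \<times> 'y) list \<times> ('x \<times> 'y) list) set"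
  for R X Y where
  refl: "l \<in> lists (carrier X \<times> carrier Y) \<Longrightarrow> (l, l) \<in> tensor_rel R X Y"
| sym: "(l, m) \<in> tensor_rel R X Y \<Longrightarrow> (m, l) \<in> tensor_rel R X Y"
| trans: "(l, m) \<in> tensor_rel R X Y \<Longrightarrow> (m, n) \<in> tensor_rel R X Y \<Longrightarrow> (l, n) \<in> tensor_rel R X Y"
| append: "(l, l') \<in> tensor_rel R X Y \<Longrightarrow> (m, m') \<in> tensor_rel R X Y
    \<Longrightarrow> (l @ m, l' @ m') \<in> tensor_rel R X Y"
| commute: "l \<in> lists (carrier X \<times> carrier Y) \<Longrightarrow> m \<in> lists (carrier X \<times> carrier Y)
    \<Longrightarrow> (l @ m, m @ l) \<in> tensor_rel R X Y"
| zero: "y \<in> carrier Y \<Longrightarrow> ([(\<zero>\<^bsub>X\<^esub>, y)], []) \<in> tensor_rel R X Y"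
| add_left: "x \<in> carrier X \<Longrightarrow> x' \<in> carrier X \<Longrightarrow> y \<in> carrier Y
    \<Longrightarrow> ([(x \<oplus>\<^bsub>X\<^esub> x', y)], [(x, y), (x', y)]) \<in> tensor_rel R X Y"
| add_right: "x \<in> carrier X \<Longrightarrow> y \<in> carrier Y \<Longrightarrow> y' \<in> carrier Y
    \<Longrightarrow> ([(x, y \<oplus>\<^bsub>Y\<^esub> y')], [(x, y), (x, y')]) \<in> tensor_rel R X Y"
| smult: "r \<in> carrier R \<Longrightarrow> x \<in> carrier X \<Longrightarrow> y \<in> carrier Y
    \<Longrightarrow> ([(r \<odot>\<^bsub>X\<^esub> x, y)], [(x, r \<odot>\<^bsub>Y\<^esub> y)]) \<in> tensor_rel R X Y"

definition tensor_class ::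
    "('k, 'r) ring_scheme \<Rightarrow> ('k, 'x, 'p) module_scheme \<Rightarrow> ('k, 'y, 'q) module_scheme
      \<Rightarrow> ('x \<times> 'y) list \<Rightarrow> ('x \<times> 'y) list set"
  where "tensor_class R X Y l = tensor_rel R X Y `` {l}"

definition tensor_rep :: "('x \<times> 'y) list set \<Rightarrow> ('x \<times> 'y) list"
  where "tensor_rep t = (SOME l. l \<in> t)"

text \<open>The fields \<open>mult\<close> and \<open>one\<close> give the componentwise algebra structure when \<open>X\<close> and \<open>Y\<close> are
  algebras, and are meaningless otherwise.\<close>

definition tensor ::
    "('k, 'r) ring_scheme \<Rightarrow> ('k, 'x, 'p) module_scheme \<Rightarrow> ('k, 'y, 'q) module_scheme
      \<Rightarrow> ('k, ('x \<times> 'y) list set) module"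
  where "tensor R X Y =
    \<lparr>carrier = lists (carrier X \<times> carrier Y) // tensor_rel R X Y,
     mult = (\<lambda>s t. tensor_class R X Y
        [(x \<otimes>\<^bsub>X\<^esub> x', y \<otimes>\<^bsub>Y\<^esub> y'). (x, y) \<leftarrow> tensor_rep s, (x', y') \<leftarrow> tensor_rep t]),
     one = tensor_class R X Y [(\<one>\<^bsub>X\<^esub>, \<one>\<^bsub>Y\<^esub>)],
     zero = tensor_class R X Y [],
     add = (\<lambda>s t. tensor_class R X Y (tensor_rep s @ tensor_rep t)),
     smult = (\<lambda>r t. tensor_class R X Y [(r \<odot>\<^bsub>X\<^esub> x, y). (x, y) \<leftarrow> tensor_rep t])\<rparr>"

definition pure_tensor ::
    "('k, 'r) ring_scheme \<Rightarrow> ('k, 'x, 'p) module_scheme \<Rightarrow> ('k, 'y, 'q) module_scheme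
      \<Rightarrow> 'x \<Rightarrow> 'y \<Rightarrow> ('x \<times> 'y) list set"
  where "pure_tensor R X Y x y = tensor_class R X Y [(x, y)]"

text \<open>For bilinear \<open>f : X \<times> Y \<rightarrow> Z\<close>, the value at \<open>t\<close> of the induced linear map \<open>X \<otimes> Y \<rightarrow> Z\<close>;
  bilinearity makes it independent of the representative chosen.\<close>

definition tensor_lift ::
    "('k, 'z, 's) module_scheme \<Rightarrow> ('x \<Rightarrow> 'y \<Rightarrow> 'z) \<Rightarrow> ('x \<times> 'y) list set \<Rightarrow> 'z"
  where "tensor_lift Z f t = foldr (\<lambda>(x, y) z. f x y \<oplus>\<^bsub>Z\<^esub> z) (tensor_rep t) \<zero>\<^bsub>Z\<^esub>"

definition wedge ::
    "('k, 'r) ring_scheme \<Rightarrow> ('k, 'v, 'p) module_scheme \<Rightarrow> 'v \<Rightarrow> 'v \<Rightarrow> ('v \<times> 'v) list set"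
  where "wedge R V v v' = pure_tensor R V V v v' \<ominus>\<^bsub>tensor R V V\<^esub> pure_tensor R V V v' v"

definition wedge_module ::
    "('k, 'r) ring_scheme \<Rightarrow> ('k, 'v, 'p) module_scheme \<Rightarrow> ('k, ('v \<times> 'v) list set) module"
  where "wedge_module R V = (tensor R V V)
    \<lparr>carrier := submodule_span R (tensor R V V)
       {wedge R V v v' | v v'. v \<in> carrier V \<and> v' \<in> carrier V}\<rparr>"


section \<open>Algebras, Hopf algebras and their modules\<close>

text \<open>The locale \<open>algebra\<close> of the library is restricted to commutative algebras.\<close>

locale assoc_algebra = module R A + ring A
  for R :: "('k, 'r) ring_scheme" and A :: "('k, 'a, 'c) module_scheme" +
  assumes smult_mult_left: "\<lbrakk>r \<in> carrier R; x \<in> carrier A; y \<in> carrier A\<rbrakk>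
      \<Longrightarrow> (r \<odot>\<^bsub>A\<^esub> x) \<otimes>\<^bsub>A\<^esub> y = r \<odot>\<^bsub>A\<^esub> (x \<otimes>\<^bsub>A\<^esub> y)"
    and smult_mult_right: "\<lbrakk>r \<in> carrier R; x \<in> carrier A; y \<in> carrier A\<rbrakk>
      \<Longrightarrow> x \<otimes>\<^bsub>A\<^esub> (r \<odot>\<^bsub>A\<^esub> y) = r \<odot>\<^bsub>A\<^esub> (x \<otimes>\<^bsub>A\<^esub> y)"

text \<open>Sweedler sums: \<open>sweedler2 Z \<Delta> f a\<close> is \<open>\<Sum> f a\<^sub>1 a\<^sub>2\<close> and \<open>sweedler3 Z \<Delta> f a\<close> is
  \<open>\<Sum> f a\<^sub>1 a\<^sub>2 a\<^sub>3\<close>, where \<open>f\<close> is multilinear with values in \<open>Z\<close>; the iterated coproduct is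
  \<open>(\<Delta> \<otimes> id) \<circ> \<Delta>\<close>.\<close>

definition sweedler2 ::
    "('k, 'z, 's) module_scheme \<Rightarrow> ('a \<Rightarrow> ('a \<times> 'a) list set) \<Rightarrow> ('a \<Rightarrow> 'a \<Rightarrow> 'z) \<Rightarrow> 'a \<Rightarrow> 'z"
  where "sweedler2 Z \<Delta> f a = tensor_lift Z f (\<Delta> a)"

definition sweedler3 ::
    "('k, 'z, 's) module_scheme \<Rightarrow> ('a \<Rightarrow> ('a \<times> 'a) list set) \<Rightarrow> ('a \<Rightarrow> 'a \<Rightarrow> 'a \<Rightarrow> 'z) \<Rightarrow> 'a \<Rightarrow> 'z"
  where "sweedler3 Z \<Delta> f a = sweedler2 Z \<Delta> (\<lambda>x a\<^sub>3. sweedler2 Z \<Delta> (\<lambda>a\<^sub>1 a\<^sub>2. f a\<^sub>1 a\<^sub>2 a\<^sub>3) x) a"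

text \<open>In \<open>coassoc\<close> both sides are \<open>\<Sum> a\<^sub>1 \<otimes> (a\<^sub>2 \<otimes> a\<^sub>3)\<close>, for the two bracketings of the iterated
  coproduct.\<close>

locale hopf_algebra = assoc_algebra R A
  for R :: "('k, 'r) ring_scheme" and A :: "('k, 'a, 'c) module_scheme" +
  fixes \<Delta> :: "'a \<Rightarrow> ('a \<times> 'a) list set" and \<epsilon> :: "'a \<Rightarrow> 'k" and S :: "'a \<Rightarrow> 'a"
  assumes comult_linear: "\<Delta> \<in> linear_maps R A (tensor R A A)"
    and comult_ring_hom: "\<Delta> \<in> ring_hom A (tensor R A A)"
    and counit_linear: "\<lbrakk>r \<in> carrier R; a \<in> carrier A\<rbrakk> \<Longrightarrow> \<epsilon> (r \<odot>\<^bsub>A\<^esub> a) = r \<otimes>\<^bsub>R\<^esub> \<epsilon> a"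
    and counit_ring_hom: "\<epsilon> \<in> ring_hom A R"
    and antipode_linear: "S \<in> linear_maps R A A"
    and coassoc: "a \<in> carrier A \<Longrightarrow>
      sweedler3 (tensor R A (tensor R A A)) \<Delta>
        (\<lambda>a\<^sub>1 a\<^sub>2 a\<^sub>3. pure_tensor R A (tensor R A A) a\<^sub>1 (pure_tensor R A A a\<^sub>2 a\<^sub>3)) a =
      sweedler2 (tensor R A (tensor R A A)) \<Delta>
        (\<lambda>a\<^sub>1 x. pure_tensor R A (tensor R A A) a\<^sub>1 (\<Delta> x)) a"
    and counit_left: "a \<in> carrier A \<Longrightarrow> sweedler2 A \<Delta> (\<lambda>a\<^sub>1 a\<^sub>2. \<epsilon> a\<^sub>1 \<odot>\<^bsub>A\<^esub> a\<^sub>2) a = a"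
    and counit_right: "a \<in> carrier A \<Longrightarrow> sweedler2 A \<Delta> (\<lambda>a\<^sub>1 a\<^sub>2. \<epsilon> a\<^sub>2 \<odot>\<^bsub>A\<^esub> a\<^sub>1) a = a"
    and antipode_left: "a \<in> carrier A \<Longrightarrow>
      sweedler2 A \<Delta> (\<lambda>a\<^sub>1 a\<^sub>2. S a\<^sub>1 \<otimes>\<^bsub>A\<^esub> a\<^sub>2) a = \<epsilon> a \<odot>\<^bsub>A\<^esub> \<one>\<^bsub>A\<^esub>"
    and antipode_right: "a \<in> carrier A \<Longrightarrow>
      sweedler2 A \<Delta> (\<lambda>a\<^sub>1 a\<^sub>2. a\<^sub>1 \<otimes>\<^bsub>A\<^esub> S a\<^sub>2) a = \<epsilon> a \<odot>\<^bsub>A\<^esub> \<one>\<^bsub>A\<^esub>"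

locale cocommutative_hopf_algebra = hopf_algebra +
  assumes cocommutative: "a \<in> carrier A \<Longrightarrow>
    sweedler2 (tensor R A A) \<Delta> (\<lambda>a\<^sub>1 a\<^sub>2. pure_tensor R A A a\<^sub>2 a\<^sub>1) a = \<Delta> a"

locale algebra_module = A: assoc_algebra R A + V: module R V
  for R :: "('k, 'r) ring_scheme" and A :: "('k, 'a, 'c) module_scheme"
    and V :: "('k, 'v, 'd) module_scheme" +
  fixes act :: "'a \<Rightarrow> 'v \<Rightarrow> 'v"
  assumes act_linear: "a \<in> carrier A \<Longrightarrow> act a \<in> linear_maps R V V"
    and act_add: "\<lbrakk>a \<in> carrier A; b \<in> carrier A; v \<in> carrier V\<rbrakk>
      \<Longrightarrow> act (a \<oplus>\<^bsub>A\<^esub> b) v = act a v \<oplus>\<^bsub>V\<^esub> act b v"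
    and act_smult: "\<lbrakk>r \<in> carrier R; a \<in> carrier A; v \<in> carrier V\<rbrakk>
      \<Longrightarrow> act (r \<odot>\<^bsub>A\<^esub> a) v = r \<odot>\<^bsub>V\<^esub> act a v"
    and act_one: "v \<in> carrier V \<Longrightarrow> act \<one>\<^bsub>A\<^esub> v = v"
    and act_mult: "\<lbrakk>a \<in> carrier A; b \<in> carrier A; v \<in> carrier V\<rbrakk>
      \<Longrightarrow> act (a \<otimes>\<^bsub>A\<^esub> b) v = act a (act b v)"


section \<open>Containment in an ambient algebra\<close>

definition module_contained ::
    "('k, 'r) ring_scheme \<Rightarrow> ('k, 'b, 'd) module_scheme \<Rightarrow> ('k, 'b, 'e) module_scheme \<Rightarrow> bool"
  where "module_contained R M B \<longleftrightarrow> submodule (carrier M) R B \<and>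
    (\<forall>x\<in>carrier M. \<forall>y\<in>carrier M. x \<oplus>\<^bsub>M\<^esub> y = x \<oplus>\<^bsub>B\<^esub> y) \<and>
    (\<forall>r\<in>carrier R. \<forall>x\<in>carrier M. r \<odot>\<^bsub>M\<^esub> x = r \<odot>\<^bsub>B\<^esub> x)"

definition algebra_contained ::
    "('k, 'r) ring_scheme \<Rightarrow> ('k, 'b, 'c) module_scheme \<Rightarrow> ('k, 'b, 'e) module_scheme \<Rightarrow> bool"
  where "algebra_contained R A B \<longleftrightarrow> module_contained R A B \<and> subring (carrier A) B \<and>
    (\<forall>x\<in>carrier A. \<forall>y\<in>carrier A. x \<otimes>\<^bsub>A\<^esub> y = x \<otimes>\<^bsub>B\<^esub> y) \<and> \<one>\<^bsub>A\<^esub> = \<one>\<^bsub>B\<^esub>"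

text \<open>Multiplication of \<open>B\<close> as a linear map; for submodules \<open>X, Y\<close> of \<open>B\<close> it also evaluates
  elements of \<open>X \<otimes> Y\<close>, through \<open>X \<otimes> Y \<rightarrow> B \<otimes> B \<rightarrow> B\<close>.\<close>

definition mult_map :: "('k, 'b, 'e) module_scheme \<Rightarrow> ('b \<times> 'b) list set \<Rightarrow> 'b"
  where "mult_map B t = tensor_lift B (\<lambda>x y. x \<otimes>\<^bsub>B\<^esub> y) t"

definition tau_op ::
    "('k, 'r) ring_scheme \<Rightarrow> ('k, 'a, 'c) module_scheme \<Rightarrow> ('a \<Rightarrow> ('a \<times> 'a) list set) \<Rightarrow> ('a \<Rightarrow> 'a)
      \<Rightarrow> ('k, 'm, 'd) module_scheme \<Rightarrow> ('a \<Rightarrow> 'm \<Rightarrow> 'm) \<Rightarrow> ('m \<times> 'a) list set \<Rightarrow> ('a \<times> 'm) list set"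
  where "tau_op R A \<Delta> S M act t =
    tensor_lift (tensor R A M)
      (\<lambda>m a. sweedler2 (tensor R A M) \<Delta> (\<lambda>a\<^sub>1 a\<^sub>2. pure_tensor R A M a\<^sub>1 (act (S a\<^sub>2) m)) a) t"

end

theory Submission
  imports Defs
begin

text \<open>Every condition of the theorem, apart from equivariance itself, compares two expressions
  built from four ways in which \<open>A\<close> acts on the values and the arguments of \<open>\<kappa>\<close>. Let
  \<open>X = V \<otimes> V\<close>, regard \<open>\<kappa>\<close> as a linear map \<open>\<phi> : X \<rightarrow> B\<close>, and let \<open>Y\<close> be the module of linear maps
  \<open>X \<rightarrow> B\<close>. On \<open>Y\<close> the algebra \<open>A\<close> acts by left multiplication \<open>l\<close> and right multiplication \<open>r\<close> of
  values, and by precomposition \<open>p\<close>, \<open>q\<close> with its action on the first and on the second tensor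
  factor. Each of the four is unital and either multiplicative or antimultiplicative, and any two of
  them commute.

  An action \<open>T\<close> of \<open>A\<close> on \<open>Y\<close> gives an operator on the linear maps \<open>\<Phi> : A \<rightarrow> Y\<close>, namely
  \<open>(T * \<Phi>) a = \<Sum> T a\<^sub>1 (\<Phi> a\<^sub>2)\<close> (the function \<open>conv\<close>). Coassociativity and cocommutativity make the
  operators of commuting actions commute (\<open>conv_commute\<close>), and the operator of \<open>T \<circ> S\<close> is a
  two-sided inverse of the operator of \<open>T\<close> (\<open>conv_antipode\<close>). So the operators \<open>L, R, P, Q\<close> of
  \<open>l, r, p, q\<close> are commuting and invertible. With \<open>K a = \<epsilon> a \<phi>\<close> the conditions become
  \<^item> Yetter--Drinfeld: \<open>P R K = L Q\<^sup>-\<^sup>1 K\<close>,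
  \<^item> compatibility: \<open>L K = P Q R K\<close>,
  \<^item> the formula for \<open>\<kappa>(v, v') a\<close>: \<open>R K = L P\<^sup>-\<^sup>1 Q\<^sup>-\<^sup>1 K\<close>,
  \<^item> commutation of the image with \<open>A\<close>: \<open>L K = R K\<close>.

  The first three are one equation up to invertible operators. The extra hypothesis
  \<open>\<kappa>(a(v), v') = \<kappa>(v, S(a)(v'))\<close> says \<open>P K = Q\<^sup>-\<^sup>1 K\<close>, which turns \<open>P Q R K\<close> into \<open>R K\<close>. All this is
  \<open>conv_equation_equivalences\<close>.

  Equivariance mentions the action on \<open>M\<close>, and this is where the relation
  \<open>m a = \<Sum> a\<^sub>1 S(a\<^sub>2)(m)\<close> in \<open>B\<close> enters. On linear maps \<open>M \<rightarrow> B\<close> let \<open>N\<close> be the operator of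
  precomposition with the action, and let \<open>I\<close> be the constant family of the inclusion, weighted by
  \<open>\<epsilon>\<close>. The relation reads \<open>R I = L N\<^sup>-\<^sup>1 I\<close>, hence \<open>N I = L R\<^sup>-\<^sup>1 I\<close>: the action on \<open>M\<close> is the adjoint
  action \<open>a(m) = \<Sum> a\<^sub>1 m S(a\<^sub>2)\<close> (\<open>action_eq_conjugation\<close>). Equivariance therefore reads
  \<open>L R\<^sup>-\<^sup>1 K = P Q K\<close>, and it joins the other conditions.

  What remains is to make Sweedler sums well behaved. They are computed from an arbitrary
  representative of \<open>\<Delta> a\<close>, so each identity about them is obtained by applying to an identity between
  tensors the linear map that a bilinear map induces.\<close>

section \<open>Linear and bilinear maps\<close>

lemma linear_mapsI:
  assumes "\<And>x. x \<in> carrier X \<Longrightarrow> f x \<in> carrier Y"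
    and "\<And>x x'. x \<in> carrier X \<Longrightarrow> x' \<in> carrier X \<Longrightarrow> f (x \<oplus>\<^bsub>X\<^esub> x') = f x \<oplus>\<^bsub>Y\<^esub> f x'"
    and "\<And>r x. r \<in> carrier R \<Longrightarrow> x \<in> carrier X \<Longrightarrow> f (r \<odot>\<^bsub>X\<^esub> x) = r \<odot>\<^bsub>Y\<^esub> f x"
  shows "f \<in> linear_maps R X Y"
  using assms by (auto simp: linear_maps_def)

lemma linear_maps_closed: "f \<in> linear_maps R X Y \<Longrightarrow> x \<in> carrier X \<Longrightarrow> f x \<in> carrier Y"
  by (auto simp: linear_maps_def)

lemma linear_maps_add:
  "f \<in> linear_maps R X Y \<Longrightarrow> x \<in> carrier X \<Longrightarrow> x' \<in> carrier X \<Longrightarrow>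
    f (x \<oplus>\<^bsub>X\<^esub> x') = f x \<oplus>\<^bsub>Y\<^esub> f x'"
  by (simp add: linear_maps_def)

lemma linear_maps_smult:
  "f \<in> linear_maps R X Y \<Longrightarrow> r \<in> carrier R \<Longrightarrow> x \<in> carrier X \<Longrightarrow>
    f (r \<odot>\<^bsub>X\<^esub> x) = r \<odot>\<^bsub>Y\<^esub> f x"
  by (simp add: linear_maps_def)

lemma linear_maps_zero:
  assumes "module R X" "module R Y" "f \<in> linear_maps R X Y"
  shows "f \<zero>\<^bsub>X\<^esub> = \<zero>\<^bsub>Y\<^esub>"
proof -
  interpret X: module R X by fact
  interpret Y: module R Y by fact
  have "f (\<zero>\<^bsub>R\<^esub> \<odot>\<^bsub>X\<^esub> \<zero>\<^bsub>X\<^esub>) = \<zero>\<^bsub>R\<^esub> \<odot>\<^bsub>Y\<^esub> f \<zero>\<^bsub>X\<^esub>"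
    by (intro linear_maps_smult[OF assms(3)]) auto
  then show ?thesis
    using linear_maps_closed[OF assms(3), of "\<zero>\<^bsub>X\<^esub>"] by simp
qed

lemma linear_maps_compose:
  "f \<in> linear_maps R X Y \<Longrightarrow> g \<in> linear_maps R Y Z \<Longrightarrow> (\<lambda>x. g (f x)) \<in> linear_maps R X Z"
  by (auto simp: linear_maps_def Pi_iff)

definition bilinear_map ::
    "('k, 'r) ring_scheme \<Rightarrow> ('k, 'x, 'p) module_scheme \<Rightarrow> ('k, 'y, 'q) module_scheme
      \<Rightarrow> ('k, 'z, 's) module_scheme \<Rightarrow> ('x \<Rightarrow> 'y \<Rightarrow> 'z) \<Rightarrow> bool"
  where "bilinear_map R X Y Z f \<longleftrightarrow>
    (\<forall>y\<in>carrier Y. (\<lambda>x. f x y) \<in> linear_maps R X Z) \<and>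
    (\<forall>x\<in>carrier X. (\<lambda>y. f x y) \<in> linear_maps R Y Z)"

lemma bilinear_mapI:
  assumes "\<And>y. y \<in> carrier Y \<Longrightarrow> (\<lambda>x. f x y) \<in> linear_maps R X Z"
    and "\<And>x. x \<in> carrier X \<Longrightarrow> (\<lambda>y. f x y) \<in> linear_maps R Y Z"
  shows "bilinear_map R X Y Z f"
  using assms by (simp add: bilinear_map_def)

lemma bilinear_map_left: "bilinear_map R X Y Z f \<Longrightarrow> y \<in> carrier Y \<Longrightarrow> (\<lambda>x. f x y) \<in> linear_maps R X Z"
  and bilinear_map_right: "bilinear_map R X Y Z f \<Longrightarrow> x \<in> carrier X \<Longrightarrow> f x \<in> linear_maps R Y Z"
  by (simp_all add: bilinear_map_def)

lemma bilinear_map_closed: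
  "bilinear_map R X Y Z f \<Longrightarrow> x \<in> carrier X \<Longrightarrow> y \<in> carrier Y \<Longrightarrow> f x y \<in> carrier Z"
  by (auto simp: bilinear_map_def linear_maps_def)

lemma bilinear_map_swap: "bilinear_map R X Y Z f \<Longrightarrow> bilinear_map R Y X Z (\<lambda>y x. f x y)"
  by (simp add: bilinear_map_def)

lemma bilinear_map_compose:
  assumes f: "bilinear_map R X Y Z f" and p: "p \<in> linear_maps R X' X" and q: "q \<in> linear_maps R Y' Y"
  shows "bilinear_map R X' Y' Z (\<lambda>x y. f (p x) (q y))"
  by (intro bilinear_mapI linear_maps_compose[OF p] linear_maps_compose[OF q]
      bilinear_map_left[OF f] bilinear_map_right[OF f] linear_maps_closed[OF p] linear_maps_closed[OF q])

lemma bilinear_map_post: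
  assumes f: "bilinear_map R X Y Z f" and h: "h \<in> linear_maps R Z W"
  shows "bilinear_map R X Y W (\<lambda>x y. h (f x y))"
  by (intro bilinear_mapI linear_maps_compose[OF _ h] bilinear_map_left[OF f] bilinear_map_right[OF f])

lemma linear_maps_id: "(\<lambda>x. x) \<in> linear_maps R X X"
  by (simp add: linear_maps_def)

lemma (in assoc_algebra) mult_bilinear: "bilinear_map R A A A (\<lambda>x y. x \<otimes>\<^bsub>A\<^esub> y)"
  by (intro bilinear_mapI linear_mapsI)
    (simp_all add: l_distr r_distr smult_mult_left smult_mult_right)

lemma module_contained_inclusion:
  assumes "module_contained R M B"
  shows "(\<lambda>m. m) \<in> linear_maps R M B"
proof -
  interpret submodule "carrier M" R B using assms by (simp add: module_contained_def)
  show ?thesis using assms subset by (intro linear_mapsI) (auto simp: module_contained_def)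
qed

section \<open>Modules of linear maps\<close>

text \<open>Restriction to the carrier makes equality of two elements a statement about their values on
  \<open>X\<close>, which the group laws need.\<close>

definition hom_module ::
    "('k, 'r) ring_scheme \<Rightarrow> ('k, 'x, 'p) module_scheme \<Rightarrow> ('k, 'z, 's) module_scheme
      \<Rightarrow> ('k, 'x \<Rightarrow> 'z) module"
  where "hom_module R X Z =
    \<lparr>carrier = linear_maps R X Z \<inter> extensional (carrier X),
     mult = undefined, one = undefined,
     zero = (\<lambda>x\<in>carrier X. \<zero>\<^bsub>Z\<^esub>),
     add = (\<lambda>f g. \<lambda>x\<in>carrier X. f x \<oplus>\<^bsub>Z\<^esub> g x),
     smult = (\<lambda>r f. \<lambda>x\<in>carrier X. r \<odot>\<^bsub>Z\<^esub> f x)\<rparr>"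

lemma hom_module_linear: "f \<in> carrier (hom_module R X Z) \<Longrightarrow> f \<in> linear_maps R X Z"
  and hom_module_closed: "f \<in> carrier (hom_module R X Z) \<Longrightarrow> x \<in> carrier X \<Longrightarrow> f x \<in> carrier Z"
  by (auto simp: hom_module_def linear_maps_def)

lemma hom_module_eqI:
  "f \<in> carrier (hom_module R X Z) \<Longrightarrow> g \<in> carrier (hom_module R X Z) \<Longrightarrow>
    (\<And>x. x \<in> carrier X \<Longrightarrow> f x = g x) \<Longrightarrow> f = g"
  by (auto simp: hom_module_def intro: extensionalityI)

lemma hom_module_ops:
  "x \<in> carrier X \<Longrightarrow> (f \<oplus>\<^bsub>hom_module R X Z\<^esub> g) x = f x \<oplus>\<^bsub>Z\<^esub> g x"
  "x \<in> carrier X \<Longrightarrow> (r \<odot>\<^bsub>hom_module R X Z\<^esub> f) x = r \<odot>\<^bsub>Z\<^esub> f x"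
  "x \<in> carrier X \<Longrightarrow> \<zero>\<^bsub>hom_module R X Z\<^esub> x = \<zero>\<^bsub>Z\<^esub>"
  by (simp_all add: hom_module_def)

lemma restrict_hom_module:
  assumes "module R X" "f \<in> linear_maps R X Z"
  shows "restrict f (carrier X) \<in> carrier (hom_module R X Z)"
proof -
  interpret X: module R X by fact
  show ?thesis using assms(2) by (auto simp: hom_module_def linear_maps_def)
qed

lemma hom_module_module:
  assumes "module R X" "module R Z"
  shows "module R (hom_module R X Z)"
proof -
  interpret X: module R X by fact
  interpret Z: module R Z by fact
  let ?H = "hom_module R X Z"
  have add: "f \<oplus>\<^bsub>?H\<^esub> g \<in> carrier ?H" if "f \<in> carrier ?H" "g \<in> carrier ?H" for f g
  proof -
    note l = hom_module_linear[OF that(1)] hom_module_linear[OF that(2)]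
    have "(\<lambda>x. f x \<oplus>\<^bsub>Z\<^esub> g x) \<in> linear_maps R X Z"
      by (intro linear_mapsI)
        (simp_all add: l[THEN linear_maps_closed] l[THEN linear_maps_add] l[THEN linear_maps_smult]
          Z.smult_r_distr Z.a_ac)
    from restrict_hom_module[OF assms(1) this] show ?thesis by (simp add: hom_module_def)
  qed
  have smult: "r \<odot>\<^bsub>?H\<^esub> f \<in> carrier ?H" if "f \<in> carrier ?H" "r \<in> carrier R" for r f
  proof -
    note l = hom_module_linear[OF that(1)]
    have "(\<lambda>x. r \<odot>\<^bsub>Z\<^esub> f x) \<in> linear_maps R X Z"
      using that(2)
      by (intro linear_mapsI)
        (simp_all add: l[THEN linear_maps_closed] l[THEN linear_maps_add] l[THEN linear_maps_smult]
          Z.smult_r_distr Z.smult_assoc1[symmetric] X.R.m_comm)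
    from restrict_hom_module[OF assms(1) this] show ?thesis by (simp add: hom_module_def)
  qed
  have "(\<lambda>x. \<zero>\<^bsub>Z\<^esub>) \<in> linear_maps R X Z" by (intro linear_mapsI) simp_all
  from restrict_hom_module[OF assms(1) this] have zero: "\<zero>\<^bsub>?H\<^esub> \<in> carrier ?H"
    by (simp add: hom_module_def)
  note simps = hom_module_ops hom_module_closed add smult zero
  show ?thesis
  proof (intro moduleI abelian_groupI X.R.is_cring)
    show "\<exists>g\<in>carrier ?H. g \<oplus>\<^bsub>?H\<^esub> f = \<zero>\<^bsub>?H\<^esub>" if f: "f \<in> carrier ?H" for f
    proof
      show "(\<ominus>\<^bsub>R\<^esub> \<one>\<^bsub>R\<^esub>) \<odot>\<^bsub>?H\<^esub> f \<in> carrier ?H" using f by (simp add: smult)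
      then show "(\<ominus>\<^bsub>R\<^esub> \<one>\<^bsub>R\<^esub>) \<odot>\<^bsub>?H\<^esub> f \<oplus>\<^bsub>?H\<^esub> f = \<zero>\<^bsub>?H\<^esub>"
        using f
        by (intro hom_module_eqI[of _ R X Z]) (simp_all add: simps Z.smult_l_minus Z.l_neg)
    qed
  qed (auto intro!: hom_module_eqI[of _ R X Z] add smult zero
      simp: simps Z.a_ac Z.smult_l_distr Z.smult_r_distr Z.smult_assoc1)
qed

lemma evaluation_linear: "x \<in> carrier X \<Longrightarrow> (\<lambda>f. f x) \<in> linear_maps R (hom_module R X Z) Z"
  by (intro linear_mapsI) (simp_all add: hom_module_ops hom_module_closed)

text \<open>Linearity into a module of maps may be tested on values.\<close>

lemma linear_into_hom_moduleI:
  assumes "\<And>w. w \<in> carrier W \<Longrightarrow> g w \<in> carrier (hom_module R X Z)"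
    and "\<And>x. x \<in> carrier X \<Longrightarrow> (\<lambda>w. g w x) \<in> linear_maps R W Z"
    and "module R W" "module R X" "module R Z"
  shows "g \<in> linear_maps R W (hom_module R X Z)"
proof -
  interpret W: module R W by fact
  interpret H: module R "hom_module R X Z" by (intro hom_module_module assms)
  show ?thesis
    by (intro linear_mapsI assms(1) hom_module_eqI[of _ R X Z])
      (simp_all add: assms(1) hom_module_ops linear_maps_add[OF assms(2)] linear_maps_smult[OF assms(2)])
qed

section \<open>Tensor products of modules\<close>

(* Formal sums are kept as members of a set of lists: splitting membership into a statement about
   the entries would hide the closure facts of the tensor product from the simplifier. *)
declare in_listsD [rule del] in_listsI [rule del]

definition pair_sum :: "('k, 'z, 's) module_scheme \<Rightarrow> ('x \<Rightarrow> 'y \<Rightarrow> 'z) \<Rightarrow> ('x \<times> 'y) list \<Rightarrow> 'z"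
  where "pair_sum Z f l = foldr (\<lambda>(x, y) z. f x y \<oplus>\<^bsub>Z\<^esub> z) l \<zero>\<^bsub>Z\<^esub>"

lemma pair_sum_Nil [simp]: "pair_sum Z f [] = \<zero>\<^bsub>Z\<^esub>"
  and pair_sum_Cons [simp]: "pair_sum Z f (p # l) = f (fst p) (snd p) \<oplus>\<^bsub>Z\<^esub> pair_sum Z f l"
  by (simp_all add: pair_sum_def split: prod.split)

lemma pair_sum_closed:
  assumes "abelian_group Z" "\<And>x y. x \<in> carrier X \<Longrightarrow> y \<in> carrier Y \<Longrightarrow> f x y \<in> carrier Z"
    and "l \<in> lists (carrier X \<times> carrier Y)"
  shows "pair_sum Z f l \<in> carrier Z"
proof -
  interpret Z: abelian_group Z by fact
  show ?thesis using assms(3) by induction (auto simp: assms(2))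
qed

lemma pair_sum_append:
  assumes "abelian_group Z" "\<And>x y. x \<in> carrier X \<Longrightarrow> y \<in> carrier Y \<Longrightarrow> f x y \<in> carrier Z"
    and "l \<in> lists (carrier X \<times> carrier Y)" "m \<in> lists (carrier X \<times> carrier Y)"
  shows "pair_sum Z f (l @ m) = pair_sum Z f l \<oplus>\<^bsub>Z\<^esub> pair_sum Z f m"
proof -
  interpret Z: abelian_group Z by (rule assms)
  have cl: "pair_sum Z f k \<in> carrier Z" if "k \<in> lists (carrier X \<times> carrier Y)" for k
    by (rule pair_sum_closed[OF assms(1) assms(2) that])
  show ?thesis using assms(3)
    by induction (auto simp: cl assms(2,4) Z.a_assoc)
qed

lemma pair_sum_cong:
  assumes "l \<in> lists (carrier X \<times> carrier Y)"
    and "\<And>x y. x \<in> carrier X \<Longrightarrow> y \<in> carrier Y \<Longrightarrow> f x y = g x y"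
  shows "pair_sum Z f l = pair_sum Z g l"
  using assms(1) by induction (auto simp: assms(2))

lemma linear_map_pair_sum:
  assumes "module R Z" "module R W" "h \<in> linear_maps R Z W"
    and "\<And>x y. x \<in> carrier X \<Longrightarrow> y \<in> carrier Y \<Longrightarrow> f x y \<in> carrier Z"
    and "l \<in> lists (carrier X \<times> carrier Y)"
  shows "h (pair_sum Z f l) = pair_sum W (\<lambda>x y. h (f x y)) l"
proof -
  interpret Z: module R Z by fact
  note cl = pair_sum_closed[of Z X Y f, OF Z.abelian_group_axioms assms(4)]
  show ?thesis using assms(5)
    by induction (auto simp: linear_maps_zero[OF assms(1) assms(2) assms(3)] linear_maps_add[OF assms(3)] cl assms(4))
qed

lemma pair_sum_linear:
  assumes "module R Z" "l \<in> lists (carrier X \<times> carrier Y)"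
    and "\<And>x y. x \<in> carrier X \<Longrightarrow> y \<in> carrier Y \<Longrightarrow> (\<lambda>w. f w x y) \<in> linear_maps R W Z"
  shows "(\<lambda>w. pair_sum Z (f w) l) \<in> linear_maps R W Z"
proof -
  interpret Z: module R Z by fact
  show ?thesis using assms(2)
  proof induction
    case Nil
    show ?case by (intro linear_mapsI) auto
  next
    case (Cons p l)
    have p: "(\<lambda>w. f w (fst p) (snd p)) \<in> linear_maps R W Z"
      using Cons.hyps(1) by (intro assms(3)) auto
    note c = linear_maps_closed[OF p] linear_maps_closed[OF Cons.IH]
    show ?case
      by (intro linear_mapsI)
        (simp_all add: c linear_maps_add[OF p] linear_maps_add[OF Cons.IH] linear_maps_smult[OF p]
          linear_maps_smult[OF Cons.IH] Z.smult_r_distr Z.a_ac)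
  qed
qed

text \<open>The value of the lift of \<open>f\<close> does not depend on the representative: bilinearity gives both
  sides of every generating relation the same sum. Closure of both sides is carried along because
  transitivity and concatenation need it.\<close>

lemma pair_sum_tensor_rel:
  assumes "module R X" "module R Y" "module R Z" and f: "bilinear_map R X Y Z f"
    and rel: "(l, m) \<in> tensor_rel R X Y"
  shows "l \<in> lists (carrier X \<times> carrier Y) \<and> m \<in> lists (carrier X \<times> carrier Y) \<and>
    pair_sum Z f l = pair_sum Z f m"
proof -
  interpret X: module R X by fact
  interpret Y: module R Y by fact
  interpret Z: module R Z by fact
  note fc = bilinear_map_closed[OF f]
  note cl = pair_sum_closed[of Z X Y f, OF Z.abelian_group_axioms fc]
  note app = pair_sum_append[of Z X Y f, OF Z.abelian_group_axioms fc]
  have z: "f \<zero>\<^bsub>X\<^esub> y = \<zero>\<^bsub>Z\<^esub>" if "y \<in> carrier Y" for y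
    using linear_maps_zero[OF assms(1,3) bilinear_map_left[OF f that]] .
  show ?thesis using rel
  proof induction
    case (append l l' m m')
    then show ?case by (auto simp: app)
  next
    case (commute l m)
    then show ?case by (auto simp: app cl Z.a_comm)
  next
    case (add_left x x' y)
    then show ?case
      using linear_maps_add[OF bilinear_map_left[OF f]] by (auto simp: fc)
  next
    case (add_right x y y')
    then show ?case
      using linear_maps_add[OF bilinear_map_right[OF f]] by (auto simp: fc)
  next
    case (smult r x y)
    then show ?case
      using linear_maps_smult[OF bilinear_map_left[OF f]] linear_maps_smult[OF bilinear_map_right[OF f]]
      by (auto simp: fc)
  qed (auto simp: z)
qed

locale module_pair = X: module R X + Y: module R Y
  for R :: "('k, 'r) ring_scheme"
    and X :: "('k, 'x, 'p) module_scheme" and Y :: "('k, 'y, 'q) module_scheme"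
begin

abbreviation formal_sums :: "('x \<times> 'y) list set"
  where "formal_sums \<equiv> lists (carrier X \<times> carrier Y)"

abbreviation cls :: "('x \<times> 'y) list \<Rightarrow> ('x \<times> 'y) list set"
  where "cls \<equiv> tensor_class R X Y"

lemma tensor_rel_closed: "(l, m) \<in> tensor_rel R X Y \<Longrightarrow> l \<in> formal_sums \<and> m \<in> formal_sums"
  by (induction rule: tensor_rel.induct) auto

lemma equiv_tensor_rel: "equiv formal_sums (tensor_rel R X Y)"
  by (intro equivI refl_onI symI transI subsetI)
    (auto dest: tensor_rel_closed intro: tensor_rel.refl tensor_rel.sym tensor_rel.trans)

lemma class_eqI: "(l, m) \<in> tensor_rel R X Y \<Longrightarrow> cls l = cls m"
  unfolding tensor_class_def by (rule equiv_class_eq[OF equiv_tensor_rel])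

lemma class_closed: "l \<in> formal_sums \<Longrightarrow> cls l \<in> carrier (tensor R X Y)"
  by (simp add: tensor_def tensor_class_def quotientI)

text \<open>The operations of the tensor product act on chosen representatives; this lemma moves every
  computation to the representative at hand.\<close>

lemma rep_rel:
  assumes "l \<in> formal_sums"
  shows "(l, tensor_rep (cls l)) \<in> tensor_rel R X Y"
proof -
  have "tensor_rep (cls l) \<in> cls l"
    unfolding tensor_rep_def
    by (rule someI[of _ l]) (simp add: tensor_class_def tensor_rel.refl assms)
  then show ?thesis by (simp add: tensor_class_def)
qed

lemma tensor_cases:
  assumes "t \<in> carrier (tensor R X Y)"
  obtains l where "l \<in> formal_sums" "t = cls l"
  using assms by (auto simp: tensor_def tensor_class_def elim: quotientE)

lemma rep_closed: "t \<in> carrier (tensor R X Y) \<Longrightarrow> tensor_rep t \<in> formal_sums"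
  using rep_rel tensor_rel_closed by (auto elim: tensor_cases)

lemma tensor_zero: "\<zero>\<^bsub>tensor R X Y\<^esub> = cls []"
  by (simp add: tensor_def)

lemma add_class:
  assumes "l \<in> formal_sums" "m \<in> formal_sums"
  shows "cls l \<oplus>\<^bsub>tensor R X Y\<^esub> cls m = cls (l @ m)"
  using class_eqI[OF tensor_rel.append[OF rep_rel[OF assms(1)] rep_rel[OF assms(2)]]]
  by (simp add: tensor_def)

definition scale :: "'k \<Rightarrow> ('x \<times> 'y) list \<Rightarrow> ('x \<times> 'y) list"
  where "scale r l = [(r \<odot>\<^bsub>X\<^esub> x, y). (x, y) \<leftarrow> l]"

lemma scale_simps [simp]: "scale r [] = []" "scale r (p # l) = (r \<odot>\<^bsub>X\<^esub> fst p, snd p) # scale r l"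
    "scale r (l @ m) = scale r l @ scale r m"
  by (simp_all add: scale_def split: prod.split)

lemma scale_closed: "l \<in> formal_sums \<Longrightarrow> r \<in> carrier R \<Longrightarrow> scale r l \<in> formal_sums"
  by (induction l) auto

text \<open>Scalars act on the first factors. The relation that moves a scalar \<open>s\<close> across is respected
  because \<open>R\<close> is commutative.\<close>

lemma scale_rel:
  assumes r: "r \<in> carrier R" and "(l, m) \<in> tensor_rel R X Y"
  shows "(scale r l, scale r m) \<in> tensor_rel R X Y"
  using assms(2)
proof induction
  case (refl l) then show ?case by (intro tensor_rel.refl scale_closed r)
next
  case (commute l m)
  then show ?case using tensor_rel.commute[of "scale r l" X Y "scale r m"] by (simp add: scale_closed r)
next
  case (zero y)
  then show ?case using r by (auto intro: tensor_rel.zero)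
next
  case (add_left x x' y)
  then show ?case using r by (auto simp: X.smult_r_distr intro: tensor_rel.add_left)
next
  case (add_right x y y')
  then show ?case using r by (auto intro: tensor_rel.add_right)
next
  case (smult s x y)
  have "r \<odot>\<^bsub>X\<^esub> (s \<odot>\<^bsub>X\<^esub> x) = s \<odot>\<^bsub>X\<^esub> (r \<odot>\<^bsub>X\<^esub> x)"
    using smult r by (simp add: X.smult_assoc1[symmetric] X.R.m_comm)
  then show ?case using smult r by (auto intro: tensor_rel.smult)
qed (auto intro: tensor_rel.intros)

lemma smult_class:
  assumes "l \<in> formal_sums" "r \<in> carrier R"
  shows "r \<odot>\<^bsub>tensor R X Y\<^esub> cls l = cls (scale r l)"
  using class_eqI[OF scale_rel[OF assms(2) rep_rel[OF assms(1)]]]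
  by (simp add: tensor_def scale_def)

lemma pure_tensor_eq: "pure_tensor R X Y x y = cls [(x, y)]"
  by (simp add: pure_tensor_def)

lemma class_Cons:
  assumes "l \<in> formal_sums" "p \<in> carrier X \<times> carrier Y"
  shows "cls (p # l) = cls [p] \<oplus>\<^bsub>tensor R X Y\<^esub> cls l"
  using assms by (simp add: add_class)

text \<open>Splitting the scalar in each summand interleaves the two scaled sums, so each step of the
  induction moves one summand past the tail of the other sum.\<close>

lemma scale_class_add:
  assumes "l \<in> formal_sums" "r \<in> carrier R" "s \<in> carrier R"
  shows "cls (scale (r \<oplus>\<^bsub>R\<^esub> s) l) = cls (scale r l @ scale s l)"
  using assms(1)
proof (induction l)
  case Nil
  show ?case by simp
next
  case (Cons p l)
  obtain x y where p: "p = (x, y)" "x \<in> carrier X" "y \<in> carrier Y" using Cons.hyps by auto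
  let ?r = "(r \<odot>\<^bsub>X\<^esub> x, y)" and ?s = "(s \<odot>\<^bsub>X\<^esub> x, y)"
  note c = scale_closed[OF Cons.hyps(2)] assms(2,3) p(2,3)
  have "cls (scale (r \<oplus>\<^bsub>R\<^esub> s) (p # l)) =
      cls [((r \<oplus>\<^bsub>R\<^esub> s) \<odot>\<^bsub>X\<^esub> x, y)] \<oplus>\<^bsub>tensor R X Y\<^esub> cls (scale (r \<oplus>\<^bsub>R\<^esub> s) l)"
    using c by (simp add: p add_class)
  also have "cls [((r \<oplus>\<^bsub>R\<^esub> s) \<odot>\<^bsub>X\<^esub> x, y)] = cls [?r, ?s]"
    using c by (intro class_eqI) (auto simp: X.smult_l_distr intro: tensor_rel.add_left)
  also have "cls [?r, ?s] \<oplus>\<^bsub>tensor R X Y\<^esub> cls (scale (r \<oplus>\<^bsub>R\<^esub> s) l) =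
      cls ([?r] @ ([?s] @ scale r l) @ scale s l)"
    using c by (simp add: Cons.IH add_class)
  also have "\<dots> = cls ([?r] @ (scale r l @ [?s]) @ scale s l)"
    using c by (intro class_eqI tensor_rel.append tensor_rel.commute tensor_rel.refl) auto
  finally show ?case using p(1) by simp
qed

lemma class_scale_zero:
  assumes "l \<in> formal_sums"
  shows "cls (scale \<zero>\<^bsub>R\<^esub> l) = cls []"
  using assms
proof (induction l)
  case Nil
  show ?case by simp
next
  case (Cons p l)
  obtain x y where p: "p = (x, y)" "x \<in> carrier X" "y \<in> carrier Y" using Cons.hyps by auto
  have "cls (scale \<zero>\<^bsub>R\<^esub> (p # l)) = cls [(\<zero>\<^bsub>X\<^esub>, y)] \<oplus>\<^bsub>tensor R X Y\<^esub> cls (scale \<zero>\<^bsub>R\<^esub> l)"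
    using p scale_closed[OF Cons.hyps(2)] by (simp add: add_class)
  also have "\<dots> = cls [] \<oplus>\<^bsub>tensor R X Y\<^esub> cls []"
    using class_eqI[OF tensor_rel.zero[OF p(3)]] by (simp add: Cons.IH)
  finally show ?case by (simp add: add_class)
qed

lemma scale_assoc:
  "l \<in> formal_sums \<Longrightarrow> r \<in> carrier R \<Longrightarrow> s \<in> carrier R \<Longrightarrow>
    scale (r \<otimes>\<^bsub>R\<^esub> s) l = scale r (scale s l)"
  by (induction l) (auto simp: X.smult_assoc1)

lemma scale_one: "l \<in> formal_sums \<Longrightarrow> scale \<one>\<^bsub>R\<^esub> l = l"
  by (induction l) auto

text \<open>The relations contain no negatives: the additive inverse of \<open>t\<close> is \<open>(\<ominus>\<one>) \<odot> t\<close>.\<close>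

lemma tensor_module: "module R (tensor R X Y)"
proof (intro moduleI abelian_groupI X.R.is_cring)
  note [simp] = add_class smult_class tensor_zero class_closed scale_closed
  let ?T = "tensor R X Y"
  show "x \<oplus>\<^bsub>?T\<^esub> y \<in> carrier ?T" if "x \<in> carrier ?T" "y \<in> carrier ?T" for x y
    using that by (auto elim!: tensor_cases)
  show "\<zero>\<^bsub>?T\<^esub> \<in> carrier ?T" by simp
  show "x \<oplus>\<^bsub>?T\<^esub> y \<oplus>\<^bsub>?T\<^esub> z = x \<oplus>\<^bsub>?T\<^esub> (y \<oplus>\<^bsub>?T\<^esub> z)"
    if "x \<in> carrier ?T" "y \<in> carrier ?T" "z \<in> carrier ?T" for x y z
    using that by (auto elim!: tensor_cases)
  show "x \<oplus>\<^bsub>?T\<^esub> y = y \<oplus>\<^bsub>?T\<^esub> x" if "x \<in> carrier ?T" "y \<in> carrier ?T" for x y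
    using that by (elim tensor_cases) (simp, intro class_eqI tensor_rel.commute)
  show "\<zero>\<^bsub>?T\<^esub> \<oplus>\<^bsub>?T\<^esub> x = x" if "x \<in> carrier ?T" for x
    using that by (auto elim!: tensor_cases)
  show "\<exists>y\<in>carrier ?T. y \<oplus>\<^bsub>?T\<^esub> x = \<zero>\<^bsub>?T\<^esub>" if "x \<in> carrier ?T" for x
  proof -
    obtain l where l: "l \<in> formal_sums" "x = cls l" by (rule tensor_cases[OF \<open>x \<in> carrier ?T\<close>])
    have "cls (scale (\<ominus>\<^bsub>R\<^esub> \<one>\<^bsub>R\<^esub>) l) \<oplus>\<^bsub>?T\<^esub> x = cls (scale (\<ominus>\<^bsub>R\<^esub> \<one>\<^bsub>R\<^esub> \<oplus>\<^bsub>R\<^esub> \<one>\<^bsub>R\<^esub>) l)"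
      using l by (simp add: scale_class_add scale_one)
    also have "\<dots> = \<zero>\<^bsub>?T\<^esub>"
      using l by (simp add: X.R.l_neg class_scale_zero)
    finally show ?thesis using l by (intro bexI[of _ "cls (scale (\<ominus>\<^bsub>R\<^esub> \<one>\<^bsub>R\<^esub>) l)"]) auto
  qed
  show "\<one>\<^bsub>R\<^esub> \<odot>\<^bsub>?T\<^esub> x = x" if "x \<in> carrier ?T" for x
    using that by (auto elim!: tensor_cases simp: scale_one)
  fix r x assume rx: "r \<in> carrier R" "x \<in> carrier ?T"
  then obtain l where l: "l \<in> formal_sums" "x = cls l" by (auto elim: tensor_cases)
  show "r \<odot>\<^bsub>?T\<^esub> x \<in> carrier ?T" using rx l by simp
  show "(r \<oplus>\<^bsub>R\<^esub> s) \<odot>\<^bsub>?T\<^esub> x = r \<odot>\<^bsub>?T\<^esub> x \<oplus>\<^bsub>?T\<^esub> s \<odot>\<^bsub>?T\<^esub> x" if "s \<in> carrier R" for s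
    using rx l that by (simp add: scale_class_add)
  show "r \<odot>\<^bsub>?T\<^esub> (x \<oplus>\<^bsub>?T\<^esub> y) = r \<odot>\<^bsub>?T\<^esub> x \<oplus>\<^bsub>?T\<^esub> r \<odot>\<^bsub>?T\<^esub> y" if "y \<in> carrier ?T" for y
    using that rx l by (auto elim!: tensor_cases)
  show "(r \<otimes>\<^bsub>R\<^esub> s) \<odot>\<^bsub>?T\<^esub> x = r \<odot>\<^bsub>?T\<^esub> (s \<odot>\<^bsub>?T\<^esub> x)" if "s \<in> carrier R" for s
    using rx l that by (simp add: scale_assoc)
qed

lemma pure_tensor_bilinear: "bilinear_map R X Y (tensor R X Y) (pure_tensor R X Y)"
  by (intro bilinear_mapI linear_mapsI)
    (auto simp: pure_tensor_eq add_class smult_class class_closed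
      intro!: class_eqI intro: tensor_rel.intros)

lemma tensor_lift_class:
  assumes "module R Z" and "bilinear_map R X Y Z f" and "l \<in> formal_sums"
  shows "tensor_lift Z f (cls l) = pair_sum Z f l"
  using pair_sum_tensor_rel[OF X.module_axioms Y.module_axioms assms(1,2) rep_rel[OF assms(3)]]
  by (simp add: tensor_lift_def pair_sum_def)

lemma tensor_lift_pure:
  assumes "module R Z" and f: "bilinear_map R X Y Z f" and "x \<in> carrier X" "y \<in> carrier Y"
  shows "tensor_lift Z f (pure_tensor R X Y x y) = f x y"
proof -
  interpret Z: module R Z by fact
  show ?thesis
    using assms bilinear_map_closed[OF f] by (simp add: pure_tensor_eq tensor_lift_class)
qed

lemma tensor_lift_linear:
  assumes "module R Z" and f: "bilinear_map R X Y Z f"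
  shows "tensor_lift Z f \<in> linear_maps R (tensor R X Y) Z"
proof -
  interpret Z: module R Z by fact
  note fc = bilinear_map_closed[OF f]
  note cl = pair_sum_closed[of Z X Y f, OF Z.abelian_group_axioms fc]
  note app = pair_sum_append[of Z X Y f, OF Z.abelian_group_axioms fc]
  note lift = tensor_lift_class[OF assms]
  have scale: "pair_sum Z f (scale r l) = r \<odot>\<^bsub>Z\<^esub> pair_sum Z f l"
    if "r \<in> carrier R" "l \<in> formal_sums" for r l
    using that(2)
    by induction (auto simp: that(1) cl fc Z.smult_r_distr linear_maps_smult[OF bilinear_map_left[OF f]])
  show ?thesis
    by (intro linear_mapsI)
      (auto elim!: tensor_cases simp: add_class smult_class scale_closed lift app cl scale)
qed

end

section \<open>Sweedler sums\<close>

definition trilinear_map ::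
    "('k, 'r) ring_scheme \<Rightarrow> ('k, 'x, 'p) module_scheme \<Rightarrow> ('k, 'z, 's) module_scheme
      \<Rightarrow> ('x \<Rightarrow> 'x \<Rightarrow> 'x \<Rightarrow> 'z) \<Rightarrow> bool"
  where "trilinear_map R X Z F \<longleftrightarrow> (\<forall>x\<in>carrier X. bilinear_map R X X Z (F x)) \<and>
    (\<forall>y\<in>carrier X. \<forall>z\<in>carrier X. (\<lambda>x. F x y z) \<in> linear_maps R X Z)"

lemma trilinear_mapI:
  assumes "\<And>x y. x \<in> carrier X \<Longrightarrow> y \<in> carrier X \<Longrightarrow> (\<lambda>z. F x y z) \<in> linear_maps R X Z"
    and "\<And>x z. x \<in> carrier X \<Longrightarrow> z \<in> carrier X \<Longrightarrow> (\<lambda>y. F x y z) \<in> linear_maps R X Z"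
    and "\<And>y z. y \<in> carrier X \<Longrightarrow> z \<in> carrier X \<Longrightarrow> (\<lambda>x. F x y z) \<in> linear_maps R X Z"
  shows "trilinear_map R X Z F"
  using assms by (simp add: trilinear_map_def bilinear_map_def)

context hopf_algebra
begin

lemma A_module: "module R A" ..

lemma module_pair_A: "module_pair R A A"
  by (intro module_pair.intro A_module)

lemma comult_closed: "a \<in> carrier A \<Longrightarrow> \<Delta> a \<in> carrier (tensor R A A)"
  by (rule linear_maps_closed[OF comult_linear])

lemma comult_rep_closed: "a \<in> carrier A \<Longrightarrow> tensor_rep (\<Delta> a) \<in> lists (carrier A \<times> carrier A)"
  by (intro module_pair.rep_closed[OF module_pair_A] comult_closed)

lemma antipode_closed: "a \<in> carrier A \<Longrightarrow> S a \<in> carrier A"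
  by (rule linear_maps_closed[OF antipode_linear])

lemma counit_closed: "a \<in> carrier A \<Longrightarrow> \<epsilon> a \<in> carrier R"
  using counit_ring_hom by (rule ring_hom_closed)

lemma sweedler2_pair_sum: "sweedler2 Z \<Delta> f a = pair_sum Z f (tensor_rep (\<Delta> a))"
  by (simp add: sweedler2_def tensor_lift_def pair_sum_def)

lemma sweedler2_cong:
  assumes "a \<in> carrier A" and "\<And>x y. x \<in> carrier A \<Longrightarrow> y \<in> carrier A \<Longrightarrow> f x y = g x y"
  shows "sweedler2 Z \<Delta> f a = sweedler2 Z \<Delta> g a"
  unfolding sweedler2_pair_sum by (rule pair_sum_cong[OF comult_rep_closed[OF assms(1)] assms(2)])

lemma sweedler2_closed:
  assumes "module R Z" "a \<in> carrier A"
    and "\<And>x y. x \<in> carrier A \<Longrightarrow> y \<in> carrier A \<Longrightarrow> f x y \<in> carrier Z"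
  shows "sweedler2 Z \<Delta> f a \<in> carrier Z"
proof -
  interpret Z: module R Z by fact
  show ?thesis
    unfolding sweedler2_pair_sum
    by (rule pair_sum_closed[OF Z.abelian_group_axioms assms(3) comult_rep_closed[OF assms(2)]])
qed

lemma linear_map_sweedler2:
  assumes "module R Z" "module R W" "h \<in> linear_maps R Z W" "a \<in> carrier A"
    and "\<And>x y. x \<in> carrier A \<Longrightarrow> y \<in> carrier A \<Longrightarrow> f x y \<in> carrier Z"
  shows "h (sweedler2 Z \<Delta> f a) = sweedler2 W \<Delta> (\<lambda>x y. h (f x y)) a"
  unfolding sweedler2_pair_sum
  by (rule linear_map_pair_sum[OF assms(1-3) assms(5) comult_rep_closed[OF assms(4)]])

lemma sweedler2_linear:
  assumes "module R Z" "bilinear_map R A A Z f"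
  shows "(\<lambda>a. sweedler2 Z \<Delta> f a) \<in> linear_maps R A Z"
  unfolding sweedler2_def
  by (intro linear_maps_compose[OF comult_linear] module_pair.tensor_lift_linear[OF module_pair_A] assms)

lemma sweedler2_parameter_linear:
  assumes "module R Z" "a \<in> carrier A"
    and "\<And>x y. x \<in> carrier A \<Longrightarrow> y \<in> carrier A \<Longrightarrow> (\<lambda>w. f w x y) \<in> linear_maps R W Z"
  shows "(\<lambda>w. sweedler2 Z \<Delta> (f w) a) \<in> linear_maps R W Z"
  unfolding sweedler2_pair_sum
  by (rule pair_sum_linear[OF assms(1) comult_rep_closed[OF assms(2)] assms(3)])

text \<open>Coassociativity holds in \<open>A \<otimes> (A \<otimes> A)\<close>. A trilinear \<open>F\<close> induces a linear map \<open>h\<close> on this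
  module, by lifting first \<open>F x\<close> for each \<open>x\<close> and then the resulting bilinear map; applying \<open>h\<close> to both
  sides gives the two nestings of the Sweedler sum.\<close>

lemma sweedler3_eq_right_nested:
  assumes Z: "module R Z" and F: "trilinear_map R A Z F" and a: "a \<in> carrier A"
  shows "sweedler3 Z \<Delta> F a = sweedler2 Z \<Delta> (\<lambda>x y. sweedler2 Z \<Delta> (F x) y) a"
proof -
  let ?T = "tensor R A A"
  let ?TT = "tensor R A ?T"
  have F1: "bilinear_map R A A Z (F x)" if "x \<in> carrier A" for x
    using F that by (simp add: trilinear_map_def)
  have F2: "(\<lambda>x. F x y z) \<in> linear_maps R A Z" if "y \<in> carrier A" "z \<in> carrier A" for y z
    using F that by (simp add: trilinear_map_def)
  note T = module_pair.tensor_module[OF module_pair_A]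
  have pair: "module_pair R A ?T" by (intro module_pair.intro A_module T)
  note TT = module_pair.tensor_module[OF pair]
  note pureT = module_pair.pure_tensor_bilinear[OF module_pair_A]
  note pureTT = module_pair.pure_tensor_bilinear[OF pair]
  let ?g = "\<lambda>x. tensor_lift Z (F x)"
  have g: "bilinear_map R A ?T Z ?g"
  proof (rule bilinear_mapI)
    show "(\<lambda>x. ?g x t) \<in> linear_maps R A Z" if "t \<in> carrier ?T" for t
      unfolding tensor_lift_def pair_sum_def[symmetric]
      by (intro pair_sum_linear[OF Z module_pair.rep_closed[OF module_pair_A that]] F2)
  qed (intro module_pair.tensor_lift_linear[OF module_pair_A Z F1])
  let ?h = "tensor_lift Z ?g"
  have h: "?h \<in> linear_maps R ?TT Z"
    by (rule module_pair.tensor_lift_linear[OF pair Z g])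
  have hp: "?h (pure_tensor R A ?T x t) = ?g x t" if "x \<in> carrier A" "t \<in> carrier ?T" for x t
    by (rule module_pair.tensor_lift_pure[OF pair Z g that])
  have gp: "?g x (pure_tensor R A A y z) = F x y z"
    if "x \<in> carrier A" "y \<in> carrier A" "z \<in> carrier A" for x y z
    by (rule module_pair.tensor_lift_pure[OF module_pair_A Z F1 that(2,3)]) (rule that)
  note pT = bilinear_map_closed[OF pureT] and pTT = bilinear_map_closed[OF pureTT]
  let ?pure3 = "\<lambda>x y z. pure_tensor R A ?T x (pure_tensor R A A y z)"
  have "sweedler3 Z \<Delta> F a = ?h (sweedler3 ?TT \<Delta> ?pure3 a)"
    unfolding sweedler3_def
    using a by (subst linear_map_sweedler2[OF TT Z h])
      (auto intro!: sweedler2_cong sweedler2_closed[OF TT] pTT pT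
        simp: linear_map_sweedler2[OF TT Z h] hp gp pT pTT)
  also have "\<dots> = ?h (sweedler2 ?TT \<Delta> (\<lambda>x y. pure_tensor R A ?T x (\<Delta> y)) a)"
    by (simp add: coassoc[OF a])
  also have "\<dots> = sweedler2 Z \<Delta> (\<lambda>x y. ?h (pure_tensor R A ?T x (\<Delta> y))) a"
    by (rule linear_map_sweedler2[OF TT Z h a]) (intro pTT comult_closed)
  also have "\<dots> = sweedler2 Z \<Delta> (\<lambda>x y. sweedler2 Z \<Delta> (F x) y) a"
    by (intro sweedler2_cong[OF a]) (simp add: hp comult_closed sweedler2_def)
  finally show ?thesis .
qed

section \<open>The convolution calculus\<close>

text \<open>The operators \<open>conv Y T\<close> act on the linear maps \<open>A \<rightarrow> Y\<close>. Taking \<open>\<Phi>\<close> extensional turns the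
  identities below into equations between operators, which can be rewritten with. An element \<open>\<phi>\<close> of
  \<open>Y\<close> is represented by \<open>conv_point Y \<phi>\<close>, the counit times \<open>\<phi>\<close>, because applying operators to it
  yields the plain Sweedler sums of \<open>\<phi>\<close>.\<close>

definition conv_space :: "('k, 'y, 'q) module_scheme \<Rightarrow> ('a \<Rightarrow> 'y) set"
  where "conv_space Y = carrier (hom_module R A Y)"

definition conv ::
    "('k, 'y, 'q) module_scheme \<Rightarrow> ('a \<Rightarrow> 'y \<Rightarrow> 'y) \<Rightarrow> ('a \<Rightarrow> 'y) \<Rightarrow> 'a \<Rightarrow> 'y"
  where "conv Y T \<Phi> = (\<lambda>a\<in>carrier A. sweedler2 Y \<Delta> (\<lambda>x y. T x (\<Phi> y)) a)"

definition conv_point :: "('k, 'y, 'q) module_scheme \<Rightarrow> 'y \<Rightarrow> 'a \<Rightarrow> 'y"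
  where "conv_point Y \<phi> = (\<lambda>a\<in>carrier A. \<epsilon> a \<odot>\<^bsub>Y\<^esub> \<phi>)"

lemma conv_space_linear: "\<Phi> \<in> conv_space Y \<Longrightarrow> \<Phi> \<in> linear_maps R A Y"
  and conv_space_closed: "\<Phi> \<in> conv_space Y \<Longrightarrow> a \<in> carrier A \<Longrightarrow> \<Phi> a \<in> carrier Y"
  unfolding conv_space_def by (auto intro: hom_module_linear hom_module_closed)

lemma restrict_conv_space: "f \<in> linear_maps R A Y \<Longrightarrow> restrict f (carrier A) \<in> conv_space Y"
  unfolding conv_space_def by (rule restrict_hom_module[OF A_module])

lemma conv_space_eqI:
  "\<Phi> \<in> conv_space Y \<Longrightarrow> \<Psi> \<in> conv_space Y \<Longrightarrow> (\<And>a. a \<in> carrier A \<Longrightarrow> \<Phi> a = \<Psi> a) \<Longrightarrow> \<Phi> = \<Psi>"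
  unfolding conv_space_def by (rule hom_module_eqI)

lemma bilinear_antipode: "bilinear_map R A Y Y T \<Longrightarrow> bilinear_map R A Y Y (\<lambda>x. T (S x))"
  by (rule bilinear_map_compose[OF _ antipode_linear linear_maps_id])

context
  fixes Y :: "('k, 'y, 'q) module_scheme"
  assumes Y: "module R Y"
begin

lemma conv_closed:
  assumes T: "bilinear_map R A Y Y T" and \<Phi>: "\<Phi> \<in> conv_space Y"
  shows "conv Y T \<Phi> \<in> conv_space Y"
  unfolding conv_def
  by (intro restrict_conv_space sweedler2_linear[OF Y]
      bilinear_map_compose[OF T linear_maps_id conv_space_linear[OF \<Phi>]])

lemma trilinear_conv_conv:
  assumes T: "bilinear_map R A Y Y T" and U: "bilinear_map R A Y Y U" and \<Phi>: "\<Phi> \<in> conv_space Y"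
  shows "trilinear_map R A Y (\<lambda>x u w. T x (U u (\<Phi> w)))"
proof (rule trilinear_mapI)
  note cl = bilinear_map_closed[OF U] conv_space_closed[OF \<Phi>]
  show "(\<lambda>w. T x (U u (\<Phi> w))) \<in> linear_maps R A Y" if "x \<in> carrier A" "u \<in> carrier A" for x u
    using that
    by (intro linear_maps_compose[OF conv_space_linear[OF \<Phi>]] linear_maps_compose[OF bilinear_map_right[OF U]]
        bilinear_map_right[OF T])
  show "(\<lambda>u. T x (U u (\<Phi> w))) \<in> linear_maps R A Y" if "x \<in> carrier A" "w \<in> carrier A" for x w
    using that
    by (intro linear_maps_compose[OF bilinear_map_left[OF U]] bilinear_map_right[OF T] cl)
  show "(\<lambda>x. T x (U u (\<Phi> w))) \<in> linear_maps R A Y" if "u \<in> carrier A" "w \<in> carrier A" for u w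
    using that by (intro bilinear_map_left[OF T] cl)
qed

lemma conv_conv_right_nested:
  assumes T: "bilinear_map R A Y Y T" and U: "bilinear_map R A Y Y U" and \<Phi>: "\<Phi> \<in> conv_space Y"
    and a: "a \<in> carrier A"
  shows "conv Y T (conv Y U \<Phi>) a =
    sweedler2 Y \<Delta> (\<lambda>x y. sweedler2 Y \<Delta> (\<lambda>u w. T x (U u (\<Phi> w))) y) a"
  using a bilinear_map_closed[OF U] conv_space_closed[OF \<Phi>]
  by (auto simp: conv_def linear_map_sweedler2[OF Y Y bilinear_map_right[OF T]] intro!: sweedler2_cong)

text \<open>Coassociativity regroups the composite of two operators so that \<open>T\<close> and \<open>U\<close> share one
  coproduct; commutation and inversion are then statements about this inner sum.\<close>

lemma conv_conv:
  assumes T: "bilinear_map R A Y Y T" and U: "bilinear_map R A Y Y U" and \<Phi>: "\<Phi> \<in> conv_space Y"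
    and a: "a \<in> carrier A"
  shows "conv Y T (conv Y U \<Phi>) a =
    sweedler2 Y \<Delta> (\<lambda>z w. sweedler2 Y \<Delta> (\<lambda>x u. T x (U u (\<Phi> w))) z) a"
  unfolding conv_conv_right_nested[OF assms]
    sweedler3_eq_right_nested[OF Y trilinear_conv_conv[OF T U \<Phi>] a, symmetric]
  by (simp add: sweedler3_def)

text \<open>If \<open>T\<close> and \<open>U\<close> are convolution inverse, the inner sum collapses to a counit, which linearity of
  \<open>\<Phi>\<close> moves into its argument, where the counit axiom removes it.\<close>

lemma conv_inverse:
  assumes T: "bilinear_map R A Y Y T" and U: "bilinear_map R A Y Y U" and \<Phi>: "\<Phi> \<in> conv_space Y"
    and inv: "\<And>a \<phi>. a \<in> carrier A \<Longrightarrow> \<phi> \<in> carrier Y \<Longrightarrow>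
      sweedler2 Y \<Delta> (\<lambda>x u. T x (U u \<phi>)) a = \<epsilon> a \<odot>\<^bsub>Y\<^esub> \<phi>"
  shows "conv Y T (conv Y U \<Phi>) = \<Phi>"
proof (rule conv_space_eqI)
  show "conv Y T (conv Y U \<Phi>) \<in> conv_space Y" by (intro conv_closed T U \<Phi>)
  fix a assume a: "a \<in> carrier A"
  have "conv Y T (conv Y U \<Phi>) a = sweedler2 Y \<Delta> (\<lambda>z w. \<epsilon> z \<odot>\<^bsub>Y\<^esub> \<Phi> w) a"
    unfolding conv_conv[OF T U \<Phi> a] by (intro sweedler2_cong[OF a] inv conv_space_closed[OF \<Phi>])
  also have "\<dots> = sweedler2 Y \<Delta> (\<lambda>z w. \<Phi> (\<epsilon> z \<odot>\<^bsub>A\<^esub> w)) a"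
    by (intro sweedler2_cong[OF a])
      (simp add: linear_maps_smult[OF conv_space_linear[OF \<Phi>]] counit_closed)
  also have "\<dots> = \<Phi> (sweedler2 A \<Delta> (\<lambda>z w. \<epsilon> z \<odot>\<^bsub>A\<^esub> w) a)"
    by (rule linear_map_sweedler2[OF A_module Y conv_space_linear[OF \<Phi>] a, symmetric])
      (simp add: counit_closed)
  finally show "conv Y T (conv Y U \<Phi>) a = \<Phi> a" by (simp add: counit_left[OF a])
qed (rule \<Phi>)

lemma conv_point_closed:
  assumes "\<phi> \<in> carrier Y"
  shows "conv_point Y \<phi> \<in> conv_space Y"
proof -
  interpret Y: module R Y by (rule Y)
  show ?thesis
    unfolding conv_point_def using assms
    by (intro restrict_conv_space linear_mapsI)
      (simp_all add: counit_closed ring_hom_add[OF counit_ring_hom] counit_linear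
        Y.smult_l_distr Y.smult_assoc1)
qed

text \<open>The counit in \<open>conv_point\<close> absorbs the last coproduct, so one operator evaluates without a
  sum, two operators give a double Sweedler sum, and three a triple one.\<close>

lemma conv_conv_point:
  assumes T: "bilinear_map R A Y Y T" and \<phi>: "\<phi> \<in> carrier Y" and a: "a \<in> carrier A"
  shows "conv Y T (conv_point Y \<phi>) a = T a \<phi>"
proof -
  note lin = bilinear_map_left[OF T \<phi>]
  have "conv Y T (conv_point Y \<phi>) a = sweedler2 Y \<Delta> (\<lambda>x y. T (\<epsilon> y \<odot>\<^bsub>A\<^esub> x) \<phi>) a"
    using a \<phi>
    by (auto simp: conv_def conv_point_def counit_closed linear_maps_smult[OF lin]
        linear_maps_smult[OF bilinear_map_right[OF T]] intro!: sweedler2_cong)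
  also have "\<dots> = T (sweedler2 A \<Delta> (\<lambda>x y. \<epsilon> y \<odot>\<^bsub>A\<^esub> x) a) \<phi>"
    by (rule linear_map_sweedler2[OF A_module Y lin a, symmetric]) (simp add: counit_closed)
  finally show ?thesis by (simp add: counit_right[OF a])
qed

lemma conv_conv_point2:
  assumes T: "bilinear_map R A Y Y T" and U: "bilinear_map R A Y Y U"
    and \<phi>: "\<phi> \<in> carrier Y" and a: "a \<in> carrier A"
  shows "conv Y T (conv Y U (conv_point Y \<phi>)) a = sweedler2 Y \<Delta> (\<lambda>x y. T x (U y \<phi>)) a"
  using a by (subst conv_def) (auto intro!: sweedler2_cong simp: conv_conv_point[OF U \<phi>])

lemma conv_conv_point3:
  assumes T: "bilinear_map R A Y Y T" and U: "bilinear_map R A Y Y U" and W: "bilinear_map R A Y Y W"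
    and \<phi>: "\<phi> \<in> carrier Y" and a: "a \<in> carrier A"
  shows "conv Y T (conv Y U (conv Y W (conv_point Y \<phi>))) a =
    sweedler3 Y \<Delta> (\<lambda>x y z. T x (U y (W z \<phi>))) a"
proof -
  have "conv Y T (conv Y U (conv Y W (conv_point Y \<phi>))) a = sweedler2 Y \<Delta> (\<lambda>z w.
      sweedler2 Y \<Delta> (\<lambda>x u. T x (U u (conv Y W (conv_point Y \<phi>) w))) z) a"
    by (intro conv_conv T U a conv_closed[OF W] conv_point_closed \<phi>)
  also have "\<dots> = sweedler3 Y \<Delta> (\<lambda>x y z. T x (U y (W z \<phi>))) a"
    unfolding sweedler3_def by (intro sweedler2_cong a) (simp_all add: conv_conv_point[OF W \<phi>])
  finally show ?thesis .
qed

end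

text \<open>Right multiplication and precomposition reverse products while left multiplication preserves
  them. Over a cocommutative Hopf algebra both kinds are inverted by the antipode, so they are treated
  together.\<close>

definition one_sided_action ::
    "('k, 'y, 'q) module_scheme \<Rightarrow> ('a \<Rightarrow> 'y \<Rightarrow> 'y) \<Rightarrow> bool"
  where "one_sided_action Y T \<longleftrightarrow> bilinear_map R A Y Y T \<and> (\<forall>\<phi>\<in>carrier Y. T \<one>\<^bsub>A\<^esub> \<phi> = \<phi>) \<and>
    ((\<forall>x\<in>carrier A. \<forall>y\<in>carrier A. \<forall>\<phi>\<in>carrier Y. T x (T y \<phi>) = T (x \<otimes>\<^bsub>A\<^esub> y) \<phi>) \<or>
     (\<forall>x\<in>carrier A. \<forall>y\<in>carrier A. \<forall>\<phi>\<in>carrier Y. T x (T y \<phi>) = T (y \<otimes>\<^bsub>A\<^esub> x) \<phi>))"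

definition commuting ::
    "('k, 'y, 'q) module_scheme \<Rightarrow> ('a \<Rightarrow> 'y \<Rightarrow> 'y) \<Rightarrow> ('a \<Rightarrow> 'y \<Rightarrow> 'y) \<Rightarrow> bool"
  where "commuting Y T U \<longleftrightarrow>
    (\<forall>x\<in>carrier A. \<forall>u\<in>carrier A. \<forall>\<phi>\<in>carrier Y. T x (U u \<phi>) = U u (T x \<phi>))"

lemma one_sided_action_bilinear: "one_sided_action Y T \<Longrightarrow> bilinear_map R A Y Y T"
  by (simp add: one_sided_action_def)

end

section \<open>Cocommutativity\<close>

context cocommutative_hopf_algebra
begin

text \<open>Cocommutativity is an identity in \<open>A \<otimes> A\<close>; the linear map induced by \<open>f\<close> transports it.\<close>

lemma sweedler2_swap:
  assumes Z: "module R Z" and f: "bilinear_map R A A Z f" and a: "a \<in> carrier A"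
  shows "sweedler2 Z \<Delta> (\<lambda>x y. f y x) a = sweedler2 Z \<Delta> f a"
proof -
  let ?T = "tensor R A A"
  let ?h = "tensor_lift Z f"
  note h = module_pair.tensor_lift_linear[OF module_pair_A Z f]
  note T = module_pair.tensor_module[OF module_pair_A]
  note pT = bilinear_map_closed[OF module_pair.pure_tensor_bilinear[OF module_pair_A]]
  have "sweedler2 Z \<Delta> (\<lambda>x y. f y x) a = sweedler2 Z \<Delta> (\<lambda>x y. ?h (pure_tensor R A A y x)) a"
    by (intro sweedler2_cong[OF a]) (simp add: module_pair.tensor_lift_pure[OF module_pair_A Z f])
  also have "\<dots> = ?h (sweedler2 ?T \<Delta> (\<lambda>x y. pure_tensor R A A y x) a)"
    by (rule linear_map_sweedler2[OF T Z h a, symmetric]) (intro pT)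
  also have "\<dots> = ?h (\<Delta> a)"
    by (simp only: cocommutative[OF a])
  finally show ?thesis by (simp add: sweedler2_def)
qed

context
  fixes Y :: "('a, 'y, 'q) module_scheme"
  assumes Y: "module R Y"
begin

text \<open>In the common inner sum, cocommutativity exchanges the arguments of \<open>T\<close> and \<open>U\<close>, after which
  the commuting actions can be exchanged.\<close>

lemma conv_commute:
  assumes T: "bilinear_map R A Y Y T" and U: "bilinear_map R A Y Y U" and \<Phi>: "\<Phi> \<in> conv_space Y"
    and comm: "\<And>x u \<phi>. x \<in> carrier A \<Longrightarrow> u \<in> carrier A \<Longrightarrow> \<phi> \<in> carrier Y \<Longrightarrow>
      T x (U u \<phi>) = U u (T x \<phi>)"
  shows "conv Y T (conv Y U \<Phi>) = conv Y U (conv Y T \<Phi>)"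
proof (rule conv_space_eqI)
  show "conv Y T (conv Y U \<Phi>) \<in> conv_space Y" "conv Y U (conv Y T \<Phi>) \<in> conv_space Y"
    by (intro conv_closed[OF Y] T U \<Phi>)+
  fix a assume a: "a \<in> carrier A"
  have bil: "bilinear_map R A A Y (\<lambda>x u. T x (U u \<phi>))" if "\<phi> \<in> carrier Y" for \<phi>
    by (rule bilinear_map_compose[OF T linear_maps_id bilinear_map_left[OF U that]])
  have "conv Y T (conv Y U \<Phi>) a =
      sweedler2 Y \<Delta> (\<lambda>z w. sweedler2 Y \<Delta> (\<lambda>u x. T x (U u (\<Phi> w))) z) a"
    unfolding conv_conv[OF Y T U \<Phi> a]
    by (intro sweedler2_cong[OF a] sweedler2_swap[OF Y, symmetric] bil conv_space_closed[OF \<Phi>])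
  also have "\<dots> = conv Y U (conv Y T \<Phi>) a"
    unfolding conv_conv[OF Y U T \<Phi> a]
    by (intro sweedler2_cong[OF a] sweedler2_cong comm conv_space_closed[OF \<Phi>])
  finally show "conv Y T (conv Y U \<Phi>) a = conv Y U (conv Y T \<Phi>) a" .
qed

text \<open>By (anti)multiplicativity the inner sums are \<open>T\<close> applied to one of the products
  \<open>S a\<^sub>1 a\<^sub>2\<close>, \<open>a\<^sub>1 S a\<^sub>2\<close>, \<open>a\<^sub>2 S a\<^sub>1\<close>, \<open>S a\<^sub>2 a\<^sub>1\<close>. The first two are the antipode axioms, the other two follow by
  cocommutativity.\<close>

lemma conv_antipode:
  assumes act: "one_sided_action Y T" and \<Phi>: "\<Phi> \<in> conv_space Y"
  shows "conv Y (\<lambda>x. T (S x)) (conv Y T \<Phi>) = \<Phi>" and "conv Y T (conv Y (\<lambda>x. T (S x)) \<Phi>) = \<Phi>"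
proof -
  have T: "bilinear_map R A Y Y T" by (rule one_sided_action_bilinear[OF act])
  have one: "T \<one>\<^bsub>A\<^esub> \<phi> = \<phi>" if "\<phi> \<in> carrier Y" for \<phi>
    using act that by (simp add: one_sided_action_def)
  have mult: "(\<forall>x\<in>carrier A. \<forall>y\<in>carrier A. \<forall>\<phi>\<in>carrier Y. T x (T y \<phi>) = T (x \<otimes>\<^bsub>A\<^esub> y) \<phi>) \<or>
      (\<forall>x\<in>carrier A. \<forall>y\<in>carrier A. \<forall>\<phi>\<in>carrier Y. T x (T y \<phi>) = T (y \<otimes>\<^bsub>A\<^esub> x) \<phi>)"
    using act by (simp add: one_sided_action_def)
  note b1 = bilinear_map_compose[OF mult_bilinear antipode_linear linear_maps_id]
  note b2 = bilinear_map_compose[OF mult_bilinear linear_maps_id antipode_linear]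
  have unit: "sweedler2 Y \<Delta> (\<lambda>x y. T (g x y) \<phi>) a = \<epsilon> a \<odot>\<^bsub>Y\<^esub> \<phi>"
    if "a \<in> carrier A" "\<phi> \<in> carrier Y" "bilinear_map R A A A g"
      "sweedler2 A \<Delta> g a = \<epsilon> a \<odot>\<^bsub>A\<^esub> \<one>\<^bsub>A\<^esub>" for a \<phi> g
  proof -
    note lin = bilinear_map_left[OF T that(2)]
    have "sweedler2 Y \<Delta> (\<lambda>x y. T (g x y) \<phi>) a = T (sweedler2 A \<Delta> g a) \<phi>"
      by (rule linear_map_sweedler2[OF A_module Y lin that(1), symmetric])
        (rule bilinear_map_closed[OF that(3)])
    then show ?thesis
      using that(1,2) by (simp add: that(4) linear_maps_smult[OF lin] counit_closed one)
  qed
  have S1: "sweedler2 A \<Delta> (\<lambda>x y. y \<otimes>\<^bsub>A\<^esub> S x) a = \<epsilon> a \<odot>\<^bsub>A\<^esub> \<one>\<^bsub>A\<^esub>" if "a \<in> carrier A" for a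
    using sweedler2_swap[OF A_module b2 that] antipode_right[OF that] by simp
  have S2: "sweedler2 A \<Delta> (\<lambda>x y. S y \<otimes>\<^bsub>A\<^esub> x) a = \<epsilon> a \<odot>\<^bsub>A\<^esub> \<one>\<^bsub>A\<^esub>" if "a \<in> carrier A" for a
    using sweedler2_swap[OF A_module b1 that] antipode_left[OF that] by simp
  note b3 = bilinear_map_swap[OF b2] and b4 = bilinear_map_swap[OF b1]
  have left: "sweedler2 Y \<Delta> (\<lambda>x u. T (S x) (T u \<phi>)) a = \<epsilon> a \<odot>\<^bsub>Y\<^esub> \<phi>" (is "?L = ?R")
    and right: "sweedler2 Y \<Delta> (\<lambda>x u. T x (T (S u) \<phi>)) a = \<epsilon> a \<odot>\<^bsub>Y\<^esub> \<phi>" (is "?L' = ?R")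
    if "a \<in> carrier A" "\<phi> \<in> carrier Y" for a \<phi>
  proof -
    show "?L = ?R" using mult
    proof
      assume m: "\<forall>x\<in>carrier A. \<forall>y\<in>carrier A. \<forall>\<phi>\<in>carrier Y. T x (T y \<phi>) = T (x \<otimes>\<^bsub>A\<^esub> y) \<phi>"
      have "?L = sweedler2 Y \<Delta> (\<lambda>x u. T (S x \<otimes>\<^bsub>A\<^esub> u) \<phi>) a"
        by (intro sweedler2_cong that) (simp add: m antipode_closed that)
      then show ?thesis by (simp add: unit[OF that b1 antipode_left] that)
    next
      assume m: "\<forall>x\<in>carrier A. \<forall>y\<in>carrier A. \<forall>\<phi>\<in>carrier Y. T x (T y \<phi>) = T (y \<otimes>\<^bsub>A\<^esub> x) \<phi>"
      have "?L = sweedler2 Y \<Delta> (\<lambda>x u. T (u \<otimes>\<^bsub>A\<^esub> S x) \<phi>) a"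
        by (intro sweedler2_cong that) (simp add: m antipode_closed that)
      then show ?thesis by (simp add: unit[OF that b3 S1] that)
    qed
    show "?L' = ?R" using mult
    proof
      assume m: "\<forall>x\<in>carrier A. \<forall>y\<in>carrier A. \<forall>\<phi>\<in>carrier Y. T x (T y \<phi>) = T (x \<otimes>\<^bsub>A\<^esub> y) \<phi>"
      have "?L' = sweedler2 Y \<Delta> (\<lambda>x u. T (x \<otimes>\<^bsub>A\<^esub> S u) \<phi>) a"
        by (intro sweedler2_cong that) (simp add: m antipode_closed that)
      then show ?thesis by (simp add: unit[OF that b2 antipode_right] that)
    next
      assume m: "\<forall>x\<in>carrier A. \<forall>y\<in>carrier A. \<forall>\<phi>\<in>carrier Y. T x (T y \<phi>) = T (y \<otimes>\<^bsub>A\<^esub> x) \<phi>"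
      have "?L' = sweedler2 Y \<Delta> (\<lambda>x u. T (S u \<otimes>\<^bsub>A\<^esub> x) \<phi>) a"
        by (intro sweedler2_cong that) (simp add: m antipode_closed that)
      then show ?thesis by (simp add: unit[OF that b4 S2] that)
    qed
  qed
  show "conv Y (\<lambda>x. T (S x)) (conv Y T \<Phi>) = \<Phi>"
    by (rule conv_inverse[OF Y bilinear_antipode[OF T] T \<Phi> left])
  show "conv Y T (conv Y (\<lambda>x. T (S x)) \<Phi>) = \<Phi>"
    by (rule conv_inverse[OF Y T bilinear_antipode[OF T] \<Phi> right])
qed

lemma conv_commuting:
  assumes "one_sided_action Y T" "one_sided_action Y U" "commuting Y T U" "\<Phi> \<in> conv_space Y"
  shows "conv Y T (conv Y U \<Phi>) = conv Y U (conv Y T \<Phi>)"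
    and "conv Y (\<lambda>x. T (S x)) (conv Y U \<Phi>) = conv Y U (conv Y (\<lambda>x. T (S x)) \<Phi>)"
    and "conv Y T (conv Y (\<lambda>x. U (S x)) \<Phi>) = conv Y (\<lambda>x. U (S x)) (conv Y T \<Phi>)"
  using assms
  by (auto intro!: conv_commute bilinear_antipode
      simp: one_sided_action_def commuting_def antipode_closed)

lemma conv_action_closed:
  assumes "one_sided_action Y T" "\<Phi> \<in> conv_space Y"
  shows "conv Y T \<Phi> \<in> conv_space Y" and "conv Y (\<lambda>x. T (S x)) \<Phi> \<in> conv_space Y"
  using assms by (simp_all add: conv_closed[OF Y] bilinear_antipode one_sided_action_bilinear)

lemma conv_inject:
  assumes "one_sided_action Y T" "\<Phi> \<in> conv_space Y" "\<Psi> \<in> conv_space Y"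
  shows "conv Y T \<Phi> = conv Y T \<Psi> \<longleftrightarrow> \<Phi> = \<Psi>"
  using conv_antipode(1)[OF assms(1,2)] conv_antipode(1)[OF assms(1,3)] by metis

text \<open>Apply the operator of \<open>n\<close> to the hypothesis, which cancels \<open>n \<circ> S\<close>, and then cancel the
  operator of \<open>r\<close>.\<close>

lemma conv_exchange_inverse:
  assumes act: "one_sided_action Y l" "one_sided_action Y r" "one_sided_action Y n"
    and comm: "commuting Y r l" "commuting Y n l" "commuting Y n r"
    and \<Phi>: "\<Phi> \<in> conv_space Y"
    and eq: "conv Y r \<Phi> = conv Y l (conv Y (\<lambda>x. n (S x)) \<Phi>)"
  shows "conv Y l (conv Y (\<lambda>x. r (S x)) \<Phi>) = conv Y n \<Phi>"
proof -
  note closed = act[THEN conv_action_closed(1)] act[THEN conv_action_closed(2)] \<Phi>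
  have "conv Y r (conv Y n \<Phi>) = conv Y n (conv Y r \<Phi>)"
    by (simp add: conv_commuting[OF act(3,2) comm(3)] closed)
  also have "\<dots> = conv Y l \<Phi>"
    by (simp add: eq conv_commuting[OF act(3,1) comm(2)] conv_antipode act closed)
  also have "\<dots> = conv Y r (conv Y l (conv Y (\<lambda>x. r (S x)) \<Phi>))"
    by (simp add: conv_commuting[OF act(2,1) comm(1)] conv_antipode act closed)
  finally show ?thesis by (simp add: conv_inject act closed)
qed

text \<open>The equations differ only by the invertible operators \<open>CR\<close>, \<open>CQ\<close> and \<open>CP \<circ> CQ\<close>, applied to both
  sides. In the last equation the hypothesis replaces \<open>CP \<Phi>\<close> by \<open>CQ' \<Phi>\<close>, which \<open>CQ\<close> cancels.\<close>

lemma conv_equation_equivalences: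
  assumes act: "one_sided_action Y l" "one_sided_action Y r" "one_sided_action Y p" "one_sided_action Y q"
    and comm: "commuting Y r l" "commuting Y p l" "commuting Y q l" "commuting Y p r" "commuting Y q r"
      "commuting Y p q"
    and \<Phi>: "\<Phi> \<in> conv_space Y"
  defines "CL \<equiv> conv Y l" and "CR \<equiv> conv Y r" and "CP \<equiv> conv Y p" and "CQ \<equiv> conv Y q"
    and "CR' \<equiv> conv Y (\<lambda>x. r (S x))" and "CP' \<equiv> conv Y (\<lambda>x. p (S x))" and "CQ' \<equiv> conv Y (\<lambda>x. q (S x))"
  shows "CL (CR' \<Phi>) = CP (CQ \<Phi>) \<longleftrightarrow> CL \<Phi> = CP (CQ (CR \<Phi>))"
    and "CP (CR \<Phi>) = CL (CQ' \<Phi>) \<longleftrightarrow> CL \<Phi> = CP (CQ (CR \<Phi>))"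
    and "CR \<Phi> = CL (CP' (CQ' \<Phi>)) \<longleftrightarrow> CL \<Phi> = CP (CQ (CR \<Phi>))"
    and "CP \<Phi> = CQ' \<Phi> \<Longrightarrow> CL \<Phi> = CR \<Phi> \<longleftrightarrow> CL \<Phi> = CP (CQ (CR \<Phi>))"
proof -
  note defs = CL_def CR_def CP_def CQ_def CR'_def CP'_def CQ'_def
  have closed: "CL \<Psi> \<in> conv_space Y" "CR \<Psi> \<in> conv_space Y" "CP \<Psi> \<in> conv_space Y" "CQ \<Psi> \<in> conv_space Y"
      "CR' \<Psi> \<in> conv_space Y" "CP' \<Psi> \<in> conv_space Y" "CQ' \<Psi> \<in> conv_space Y"
    if "\<Psi> \<in> conv_space Y" for \<Psi>
    unfolding defs using that by (simp_all add: conv_action_closed act)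
  note [simp] = \<Phi> closed
  have RL: "CR (CL \<Psi>) = CL (CR \<Psi>)" and PL: "CP (CL \<Psi>) = CL (CP \<Psi>)" and QL: "CQ (CL \<Psi>) = CL (CQ \<Psi>)"
    and RP: "CP (CR \<Psi>) = CR (CP \<Psi>)" and QR: "CQ (CR \<Psi>) = CR (CQ \<Psi>)"
    and PQ: "CP (CQ \<Psi>) = CQ (CP \<Psi>)" and P'Q: "CP' (CQ \<Psi>) = CQ (CP' \<Psi>)"
    and RR': "CR (CR' \<Psi>) = \<Psi>" and PP': "CP (CP' \<Psi>) = \<Psi>" and QQ': "CQ (CQ' \<Psi>) = \<Psi>"
    if "\<Psi> \<in> conv_space Y" for \<Psi>
    unfolding defs using that
    by (simp_all add: conv_antipode act conv_commuting[OF act(2,1) comm(1)]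
        conv_commuting[OF act(3,1) comm(2)] conv_commuting[OF act(4,1) comm(3)]
        conv_commuting[OF act(3,2) comm(4)] conv_commuting[OF act(4,2) comm(5)]
        conv_commuting[OF act(3,4) comm(6)])
  have inj: "CR \<Psi> = CR \<Psi>' \<longleftrightarrow> \<Psi> = \<Psi>'" "CP \<Psi> = CP \<Psi>' \<longleftrightarrow> \<Psi> = \<Psi>'" "CQ \<Psi> = CQ \<Psi>' \<longleftrightarrow> \<Psi> = \<Psi>'"
    if "\<Psi> \<in> conv_space Y" "\<Psi>' \<in> conv_space Y" for \<Psi> \<Psi>'
    unfolding defs using that by (simp_all add: conv_inject act)
  have "CL (CR' \<Phi>) = CP (CQ \<Phi>) \<longleftrightarrow> CR (CL (CR' \<Phi>)) = CR (CP (CQ \<Phi>))"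
    by (simp add: inj)
  then show "CL (CR' \<Phi>) = CP (CQ \<Phi>) \<longleftrightarrow> CL \<Phi> = CP (CQ (CR \<Phi>))"
    by (simp add: RL RR' QR RP)
  have "CP (CR \<Phi>) = CL (CQ' \<Phi>) \<longleftrightarrow> CQ (CP (CR \<Phi>)) = CQ (CL (CQ' \<Phi>))"
    by (simp add: inj)
  then show "CP (CR \<Phi>) = CL (CQ' \<Phi>) \<longleftrightarrow> CL \<Phi> = CP (CQ (CR \<Phi>))"
    by (auto simp: QL QQ' PQ)
  have "CR \<Phi> = CL (CP' (CQ' \<Phi>)) \<longleftrightarrow> CP (CQ (CR \<Phi>)) = CP (CQ (CL (CP' (CQ' \<Phi>))))"
    by (simp add: inj)
  also have "CP (CQ (CL (CP' (CQ' \<Phi>)))) = CL \<Phi>"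
    by (simp add: QL PL P'Q[symmetric] QQ' PP')
  finally show "CR \<Phi> = CL (CP' (CQ' \<Phi>)) \<longleftrightarrow> CL \<Phi> = CP (CQ (CR \<Phi>))" by auto
  assume eq: "CP \<Phi> = CQ' \<Phi>"
  have "CP (CQ (CR \<Phi>)) = CR (CQ (CP \<Phi>))" by (simp add: PQ QR RP)
  also have "\<dots> = CR \<Phi>" by (simp add: eq QQ')
  finally show "CL \<Phi> = CR \<Phi> \<longleftrightarrow> CL \<Phi> = CP (CQ (CR \<Phi>))" by simp
qed

end

end

section \<open>Actions on the factors of a tensor product\<close>

context module_pair
begin

text \<open>Pure tensors generate the tensor product.\<close>

lemma tensor_linear_eqI:
  assumes "module R Z" "f \<in> linear_maps R (tensor R X Y) Z" "g \<in> linear_maps R (tensor R X Y) Z"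
    and pure: "\<And>x y. x \<in> carrier X \<Longrightarrow> y \<in> carrier Y \<Longrightarrow>
      f (pure_tensor R X Y x y) = g (pure_tensor R X Y x y)"
    and "t \<in> carrier (tensor R X Y)"
  shows "f t = g t"
proof -
  obtain l where l: "l \<in> formal_sums" and t: "t = cls l" using assms(5) by (rule tensor_cases)
  show ?thesis unfolding t using l
  proof induction
    case Nil
    show ?case
      using linear_maps_zero[OF tensor_module assms(1,2)] linear_maps_zero[OF tensor_module assms(1,3)]
      by (simp add: tensor_zero)
  next
    case (Cons p l)
    have "cls [p] \<in> carrier (tensor R X Y)" "cls l \<in> carrier (tensor R X Y)"
      using Cons.hyps by (auto intro: class_closed)
    moreover have "f (cls [p]) = g (cls [p])"
      using pure[of "fst p" "snd p"] Cons.hyps by (auto simp: pure_tensor_eq)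
    ultimately show ?case
      unfolding class_Cons[OF Cons.hyps(2,1)]
      by (simp add: Cons.IH linear_maps_add[OF assms(2)] linear_maps_add[OF assms(3)])
  qed
qed

lemma pure_tensor_closed:
  "x \<in> carrier X \<Longrightarrow> y \<in> carrier Y \<Longrightarrow> pure_tensor R X Y x y \<in> carrier (tensor R X Y)"
  by (rule bilinear_map_closed[OF pure_tensor_bilinear])

lemma tensor_lift_parameter_linear:
  assumes "module R Z" "t \<in> carrier (tensor R X Y)"
    and "\<And>x y. x \<in> carrier X \<Longrightarrow> y \<in> carrier Y \<Longrightarrow> (\<lambda>w. f w x y) \<in> linear_maps R W Z"
  shows "(\<lambda>w. tensor_lift Z (f w) t) \<in> linear_maps R W Z"
  unfolding tensor_lift_def pair_sum_def[symmetric]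
  by (rule pair_sum_linear[OF assms(1) rep_closed[OF assms(2)] assms(3)])

end

lemma (in algebra_module) act_bilinear: "bilinear_map R A V V act"
  by (intro bilinear_mapI act_linear linear_mapsI)
    (simp_all add: act_add act_smult linear_maps_closed[OF act_linear])

lemma (in algebra_module) act_closed: "a \<in> carrier A \<Longrightarrow> v \<in> carrier V \<Longrightarrow> act a v \<in> carrier V"
  by (rule bilinear_map_closed[OF act_bilinear])

definition act_fst ::
    "('k, 'r) ring_scheme \<Rightarrow> ('k, 'x, 'p) module_scheme \<Rightarrow> ('k, 'y, 'q) module_scheme
      \<Rightarrow> ('a \<Rightarrow> 'x \<Rightarrow> 'x) \<Rightarrow> 'a \<Rightarrow> ('x \<times> 'y) list set \<Rightarrow> ('x \<times> 'y) list set"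
  where "act_fst R X Y act a = tensor_lift (tensor R X Y) (\<lambda>x y. pure_tensor R X Y (act a x) y)"

definition act_snd ::
    "('k, 'r) ring_scheme \<Rightarrow> ('k, 'x, 'p) module_scheme \<Rightarrow> ('k, 'y, 'q) module_scheme
      \<Rightarrow> ('a \<Rightarrow> 'y \<Rightarrow> 'y) \<Rightarrow> 'a \<Rightarrow> ('x \<times> 'y) list set \<Rightarrow> ('x \<times> 'y) list set"
  where "act_snd R X Y act a = tensor_lift (tensor R X Y) (\<lambda>x y. pure_tensor R X Y x (act a y))"

lemma act_fst_linear:
  assumes "algebra_module R A X act" "module R Y"
  shows act_fst_pure: "\<lbrakk>a \<in> carrier A; x \<in> carrier X; y \<in> carrier Y\<rbrakk> \<Longrightarrow>
      act_fst R X Y act a (pure_tensor R X Y x y) = pure_tensor R X Y (act a x) y"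
    and "a \<in> carrier A \<Longrightarrow> act_fst R X Y act a \<in> linear_maps R (tensor R X Y) (tensor R X Y)"
    and "t \<in> carrier (tensor R X Y) \<Longrightarrow> (\<lambda>a. act_fst R X Y act a t) \<in> linear_maps R A (tensor R X Y)"
proof -
  interpret X: algebra_module R A X act by (rule assms)
  interpret module_pair R X Y by (intro module_pair.intro X.V.module_axioms assms(2))
  note pure = pure_tensor_bilinear
  have bil: "bilinear_map R X Y (tensor R X Y) (\<lambda>x y. pure_tensor R X Y (act a x) y)" if "a \<in> carrier A" for a
    by (rule bilinear_map_compose[OF pure X.act_linear[OF that] linear_maps_id])
  show "act_fst R X Y act a \<in> linear_maps R (tensor R X Y) (tensor R X Y)" if "a \<in> carrier A"
    unfolding act_fst_def by (rule tensor_lift_linear[OF tensor_module bil[OF that]])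
  show "(\<lambda>a. act_fst R X Y act a t) \<in> linear_maps R A (tensor R X Y)" if "t \<in> carrier (tensor R X Y)"
    unfolding act_fst_def
    by (rule tensor_lift_parameter_linear[OF tensor_module that])
      (intro linear_maps_compose[OF bilinear_map_left[OF X.act_bilinear]] bilinear_map_left[OF pure])
  show "act_fst R X Y act a (pure_tensor R X Y x y) = pure_tensor R X Y (act a x) y"
    if "a \<in> carrier A" "x \<in> carrier X" "y \<in> carrier Y"
    unfolding act_fst_def by (rule tensor_lift_pure[OF tensor_module bil[OF that(1)] that(2,3)])
qed

lemma act_fst_module:
  assumes "algebra_module R A X act" "module R Y"
  shows "algebra_module R A (tensor R X Y) (act_fst R X Y act)"
proof -
  interpret X: algebra_module R A X act by (rule assms)
  interpret module_pair R X Y by (intro module_pair.intro X.V.module_axioms assms(2))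
  let ?T = "tensor R X Y" and ?f = "act_fst R X Y act"
  note pure = act_fst_pure[OF assms] and lin = act_fst_linear(2)[OF assms] and param = act_fst_linear(3)[OF assms]
  have one: "?f \<one>\<^bsub>A\<^esub> t = t" if "t \<in> carrier ?T" for t
    by (rule tensor_linear_eqI[OF tensor_module lin[OF X.A.one_closed] linear_maps_id _ that])
      (simp add: pure X.act_one)
  have mult: "?f (a \<otimes>\<^bsub>A\<^esub> b) t = ?f a (?f b t)"
    if "a \<in> carrier A" "b \<in> carrier A" "t \<in> carrier ?T" for a b t
    by (rule tensor_linear_eqI[OF tensor_module lin[OF X.A.m_closed[OF that(1,2)]]
          linear_maps_compose[OF lin[OF that(2)] lin[OF that(1)]] _ that(3)])
      (simp only: pure X.act_mult X.act_closed that X.A.m_closed)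
  have "algebra_module_axioms R A ?T ?f"
    by (rule algebra_module_axioms.intro)
      (simp_all only: lin one mult param[THEN linear_maps_add] param[THEN linear_maps_smult])
  then show ?thesis
    by (rule algebra_module.intro[OF X.A.assoc_algebra_axioms tensor_module])
qed

lemma act_snd_linear:
  assumes "module R X" "algebra_module R A Y act"
  shows act_snd_pure: "\<lbrakk>a \<in> carrier A; x \<in> carrier X; y \<in> carrier Y\<rbrakk> \<Longrightarrow>
      act_snd R X Y act a (pure_tensor R X Y x y) = pure_tensor R X Y x (act a y)"
    and "a \<in> carrier A \<Longrightarrow> act_snd R X Y act a \<in> linear_maps R (tensor R X Y) (tensor R X Y)"
    and "t \<in> carrier (tensor R X Y) \<Longrightarrow> (\<lambda>a. act_snd R X Y act a t) \<in> linear_maps R A (tensor R X Y)"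
proof -
  interpret Y: algebra_module R A Y act by (rule assms)
  interpret module_pair R X Y by (intro module_pair.intro assms(1) Y.V.module_axioms)
  note pure = pure_tensor_bilinear
  have bil: "bilinear_map R X Y (tensor R X Y) (\<lambda>x y. pure_tensor R X Y x (act a y))" if "a \<in> carrier A" for a
    by (rule bilinear_map_compose[OF pure linear_maps_id Y.act_linear[OF that]])
  show "act_snd R X Y act a \<in> linear_maps R (tensor R X Y) (tensor R X Y)" if "a \<in> carrier A"
    unfolding act_snd_def by (rule tensor_lift_linear[OF tensor_module bil[OF that]])
  show "(\<lambda>a. act_snd R X Y act a t) \<in> linear_maps R A (tensor R X Y)" if "t \<in> carrier (tensor R X Y)"
    unfolding act_snd_def
    by (rule tensor_lift_parameter_linear[OF tensor_module that])
      (intro linear_maps_compose[OF bilinear_map_left[OF Y.act_bilinear]] bilinear_map_right[OF pure])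
  show "act_snd R X Y act a (pure_tensor R X Y x y) = pure_tensor R X Y x (act a y)"
    if "a \<in> carrier A" "x \<in> carrier X" "y \<in> carrier Y"
    unfolding act_snd_def by (rule tensor_lift_pure[OF tensor_module bil[OF that(1)] that(2,3)])
qed

lemma act_snd_module:
  assumes "module R X" "algebra_module R A Y act"
  shows "algebra_module R A (tensor R X Y) (act_snd R X Y act)"
proof -
  interpret Y: algebra_module R A Y act by (rule assms)
  interpret module_pair R X Y by (intro module_pair.intro assms(1) Y.V.module_axioms)
  let ?T = "tensor R X Y" and ?f = "act_snd R X Y act"
  note pure = act_snd_pure[OF assms] and lin = act_snd_linear(2)[OF assms] and param = act_snd_linear(3)[OF assms]
  have one: "?f \<one>\<^bsub>A\<^esub> t = t" if "t \<in> carrier ?T" for t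
    by (rule tensor_linear_eqI[OF tensor_module lin[OF Y.A.one_closed] linear_maps_id _ that])
      (simp add: pure Y.act_one)
  have mult: "?f (a \<otimes>\<^bsub>A\<^esub> b) t = ?f a (?f b t)"
    if "a \<in> carrier A" "b \<in> carrier A" "t \<in> carrier ?T" for a b t
    by (rule tensor_linear_eqI[OF tensor_module lin[OF Y.A.m_closed[OF that(1,2)]]
          linear_maps_compose[OF lin[OF that(2)] lin[OF that(1)]] _ that(3)])
      (simp only: pure Y.act_mult Y.act_closed that Y.A.m_closed)
  have "algebra_module_axioms R A ?T ?f"
    by (rule algebra_module_axioms.intro)
      (simp_all only: lin one mult param[THEN linear_maps_add] param[THEN linear_maps_smult])
  then show ?thesis
    by (rule algebra_module.intro[OF Y.A.assoc_algebra_axioms tensor_module])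
qed

lemma act_fst_act_snd_commute:
  assumes X: "algebra_module R A X actX" and Y: "algebra_module R A Y actY"
    and a: "a \<in> carrier A" and b: "b \<in> carrier A" and t: "t \<in> carrier (tensor R X Y)"
  shows "act_fst R X Y actX a (act_snd R X Y actY b t) = act_snd R X Y actY b (act_fst R X Y actX a t)"
proof -
  interpret X: algebra_module R A X actX by (rule X)
  interpret Y: algebra_module R A Y actY by (rule Y)
  interpret module_pair R X Y by (intro module_pair.intro X.V.module_axioms Y.V.module_axioms)
  note pure = act_fst_pure[OF X Y.V.module_axioms] act_snd_pure[OF X.V.module_axioms Y]
  note fst = act_fst_linear(2)[OF X Y.V.module_axioms a]
    and snd = act_snd_linear(2)[OF X.V.module_axioms Y b]
  show ?thesis
    by (rule tensor_linear_eqI[OF tensor_module linear_maps_compose[OF snd fst]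
          linear_maps_compose[OF fst snd] _ t])
      (simp add: pure X.act_closed Y.act_closed a b)
qed

section \<open>Actions on linear maps into an ambient algebra\<close>

definition left_mult_map ::
    "('k, 'x, 'p) module_scheme \<Rightarrow> ('k, 'b, 'q) module_scheme \<Rightarrow> 'b \<Rightarrow> ('x \<Rightarrow> 'b) \<Rightarrow> 'x \<Rightarrow> 'b"
  where "left_mult_map X B a \<phi> = (\<lambda>x\<in>carrier X. a \<otimes>\<^bsub>B\<^esub> \<phi> x)"

definition right_mult_map ::
    "('k, 'x, 'p) module_scheme \<Rightarrow> ('k, 'b, 'q) module_scheme \<Rightarrow> 'b \<Rightarrow> ('x \<Rightarrow> 'b) \<Rightarrow> 'x \<Rightarrow> 'b"
  where "right_mult_map X B a \<phi> = (\<lambda>x\<in>carrier X. \<phi> x \<otimes>\<^bsub>B\<^esub> a)"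

definition precompose ::
    "('k, 'x, 'p) module_scheme \<Rightarrow> ('a \<Rightarrow> 'x \<Rightarrow> 'x) \<Rightarrow> 'a \<Rightarrow> ('x \<Rightarrow> 'b) \<Rightarrow> 'x \<Rightarrow> 'b"
  where "precompose X act a \<phi> = (\<lambda>x\<in>carrier X. \<phi> (act a x))"

locale hopf_algebra_in = cocommutative_hopf_algebra R A \<Delta> \<epsilon> S + B: assoc_algebra R B
  for R :: "('k, 'r) ring_scheme" and A :: "('k, 'b, 'c) module_scheme"
    and \<Delta> \<epsilon> S and B :: "('k, 'b, 'f) module_scheme" +
  assumes contained: "algebra_contained R A B"
begin

lemma A_inclusion: "(\<lambda>a. a) \<in> linear_maps R A B"
  using contained by (intro module_contained_inclusion) (simp add: algebra_contained_def)

lemma A_in_B: "a \<in> carrier A \<Longrightarrow> a \<in> carrier B"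
  by (rule linear_maps_closed[OF A_inclusion])

lemma A_operations: "x \<in> carrier A \<Longrightarrow> y \<in> carrier A \<Longrightarrow> x \<otimes>\<^bsub>A\<^esub> y = x \<otimes>\<^bsub>B\<^esub> y" "\<one>\<^bsub>A\<^esub> = \<one>\<^bsub>B\<^esub>"
  using contained by (simp_all add: algebra_contained_def)

context
  fixes X :: "('k, 'x, 'p) module_scheme"
  assumes X: "module R X"
begin

abbreviation Hom :: "('k, 'x \<Rightarrow> 'b) module"
  where "Hom \<equiv> hom_module R X B"

text \<open>All requirements on an action of \<open>A\<close> on a module of maps are checked on values.\<close>

lemma one_sided_actionI:
  assumes closed: "\<And>a \<phi>. a \<in> carrier A \<Longrightarrow> \<phi> \<in> carrier Hom \<Longrightarrow> T a \<phi> \<in> carrier Hom"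
    and param: "\<And>\<phi> x. \<phi> \<in> carrier Hom \<Longrightarrow> x \<in> carrier X \<Longrightarrow> (\<lambda>a. T a \<phi> x) \<in> linear_maps R A B"
    and map: "\<And>a x. a \<in> carrier A \<Longrightarrow> x \<in> carrier X \<Longrightarrow> (\<lambda>\<phi>. T a \<phi> x) \<in> linear_maps R Hom B"
    and one: "\<And>\<phi> x. \<phi> \<in> carrier Hom \<Longrightarrow> x \<in> carrier X \<Longrightarrow> T \<one>\<^bsub>A\<^esub> \<phi> x = \<phi> x"
    and mult: "(\<forall>a\<in>carrier A. \<forall>b\<in>carrier A. \<forall>\<phi>\<in>carrier Hom. \<forall>x\<in>carrier X. T a (T b \<phi>) x = T (a \<otimes>\<^bsub>A\<^esub> b) \<phi> x) \<or>
      (\<forall>a\<in>carrier A. \<forall>b\<in>carrier A. \<forall>\<phi>\<in>carrier Hom. \<forall>x\<in>carrier X. T a (T b \<phi>) x = T (b \<otimes>\<^bsub>A\<^esub> a) \<phi> x)"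
  shows "one_sided_action Hom T"
proof -
  note eqI = hom_module_eqI[of _ R X B]
  have "bilinear_map R A Hom Hom T"
  proof (rule bilinear_mapI)
    show "(\<lambda>a. T a \<phi>) \<in> linear_maps R A Hom" if "\<phi> \<in> carrier Hom" for \<phi>
      by (rule linear_into_hom_moduleI[OF closed[OF _ that] param[OF that] A_module X B.module_axioms])
    show "(\<lambda>\<phi>. T a \<phi>) \<in> linear_maps R Hom Hom" if "a \<in> carrier A" for a
      by (rule linear_into_hom_moduleI[OF closed[OF that] map[OF that]
            hom_module_module[OF X B.module_axioms] X B.module_axioms])
  qed
  moreover have "T \<one>\<^bsub>A\<^esub> \<phi> = \<phi>" if "\<phi> \<in> carrier Hom" for \<phi>
    by (intro eqI closed one that one_closed)
  moreover have "T a (T b \<phi>) = T (a \<otimes>\<^bsub>A\<^esub> b) \<phi> \<longleftrightarrow> (\<forall>x\<in>carrier X. T a (T b \<phi>) x = T (a \<otimes>\<^bsub>A\<^esub> b) \<phi> x)"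
    "T a (T b \<phi>) = T (b \<otimes>\<^bsub>A\<^esub> a) \<phi> \<longleftrightarrow> (\<forall>x\<in>carrier X. T a (T b \<phi>) x = T (b \<otimes>\<^bsub>A\<^esub> a) \<phi> x)"
    if "a \<in> carrier A" "b \<in> carrier A" "\<phi> \<in> carrier Hom" for a b \<phi>
    using that by (auto intro!: eqI closed)
  ultimately show ?thesis
    using mult unfolding one_sided_action_def by simp
qed

lemma left_mult_map_closed:
  assumes "a \<in> carrier B" "\<phi> \<in> carrier Hom"
  shows "left_mult_map X B a \<phi> \<in> carrier Hom"
  unfolding left_mult_map_def
  by (intro restrict_hom_module[OF X] linear_maps_compose[OF hom_module_linear[OF assms(2)]]
      bilinear_map_right[OF B.mult_bilinear] assms)

lemma right_mult_map_closed:
  assumes "a \<in> carrier B" "\<phi> \<in> carrier Hom"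
  shows "right_mult_map X B a \<phi> \<in> carrier Hom"
  unfolding right_mult_map_def
  by (intro restrict_hom_module[OF X] linear_maps_compose[OF hom_module_linear[OF assms(2)]]
      bilinear_map_left[OF B.mult_bilinear] assms)

lemma left_mult_map_action: "one_sided_action Hom (left_mult_map X B)"
proof (rule one_sided_actionI)
  show "left_mult_map X B a \<phi> \<in> carrier Hom" if "a \<in> carrier A" "\<phi> \<in> carrier Hom" for a \<phi>
    by (intro left_mult_map_closed A_in_B that)
  show "(\<lambda>a. left_mult_map X B a \<phi> x) \<in> linear_maps R A B" if "\<phi> \<in> carrier Hom" "x \<in> carrier X" for \<phi> x
    using linear_maps_compose[OF A_inclusion bilinear_map_left[OF B.mult_bilinear hom_module_closed[OF that]]] that
    by (simp add: left_mult_map_def)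
  show "(\<lambda>\<phi>. left_mult_map X B a \<phi> x) \<in> linear_maps R Hom B" if "a \<in> carrier A" "x \<in> carrier X" for a x
    using linear_maps_compose[OF evaluation_linear[OF that(2)] bilinear_map_right[OF B.mult_bilinear A_in_B[OF that(1)]]] that
    by (simp add: left_mult_map_def)
qed (simp_all add: left_mult_map_def A_operations A_in_B hom_module_closed B.m_assoc)

lemma right_mult_map_action: "one_sided_action Hom (right_mult_map X B)"
proof (rule one_sided_actionI)
  show "right_mult_map X B a \<phi> \<in> carrier Hom" if "a \<in> carrier A" "\<phi> \<in> carrier Hom" for a \<phi>
    by (intro right_mult_map_closed A_in_B that)
  show "(\<lambda>a. right_mult_map X B a \<phi> x) \<in> linear_maps R A B" if "\<phi> \<in> carrier Hom" "x \<in> carrier X" for \<phi> x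
    using linear_maps_compose[OF A_inclusion bilinear_map_right[OF B.mult_bilinear hom_module_closed[OF that]]] that
    by (simp add: right_mult_map_def)
  show "(\<lambda>\<phi>. right_mult_map X B a \<phi> x) \<in> linear_maps R Hom B" if "a \<in> carrier A" "x \<in> carrier X" for a x
    using linear_maps_compose[OF evaluation_linear[OF that(2)] bilinear_map_left[OF B.mult_bilinear A_in_B[OF that(1)]]] that
    by (simp add: right_mult_map_def)
qed (simp_all add: right_mult_map_def A_operations A_in_B hom_module_closed B.m_assoc)

lemma right_left_commuting: "commuting Hom (right_mult_map X B) (left_mult_map X B)"
  unfolding commuting_def left_mult_map_def right_mult_map_def
  by (auto intro!: restrict_ext simp: A_in_B hom_module_closed B.m_assoc)

context
  fixes act
  assumes act: "algebra_module R A X act"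
begin

lemma precompose_action: "one_sided_action Hom (precompose X act)"
proof -
  interpret act: algebra_module R A X act by (rule act)
  show ?thesis
  proof (rule one_sided_actionI)
    show "precompose X act a \<phi> \<in> carrier Hom" if "a \<in> carrier A" "\<phi> \<in> carrier Hom" for a \<phi>
      unfolding precompose_def
      by (intro restrict_hom_module[OF X] linear_maps_compose[OF act.act_linear] hom_module_linear that)
    show "(\<lambda>a. precompose X act a \<phi> x) \<in> linear_maps R A B" if "\<phi> \<in> carrier Hom" "x \<in> carrier X" for \<phi> x
      using linear_maps_compose[OF bilinear_map_left[OF act.act_bilinear that(2)] hom_module_linear[OF that(1)]] that
      by (simp add: precompose_def)
    show "(\<lambda>\<phi>. precompose X act a \<phi> x) \<in> linear_maps R Hom B" if "a \<in> carrier A" "x \<in> carrier X" for a x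
      using evaluation_linear[OF act.act_closed[OF that]] that by (simp add: precompose_def)
  qed (simp_all add: precompose_def act.act_one act.act_mult act.act_closed)
qed

lemma precompose_commuting:
  "commuting Hom (precompose X act) (left_mult_map X B)"
  "commuting Hom (precompose X act) (right_mult_map X B)"
  unfolding commuting_def left_mult_map_def right_mult_map_def precompose_def
  by (auto intro!: restrict_ext simp: algebra_module.act_closed[OF act])

end

end

end

section \<open>Evaluation of the convolution identities\<close>

context hopf_algebra_in
begin

lemma sweedler3_cong:
  assumes "a \<in> carrier A"
    and "\<And>x y z. x \<in> carrier A \<Longrightarrow> y \<in> carrier A \<Longrightarrow> z \<in> carrier A \<Longrightarrow> f x y z = g x y z"
  shows "sweedler3 Z \<Delta> f a = sweedler3 Z \<Delta> g a"
  unfolding sweedler3_def by (intro sweedler2_cong assms)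

context
  fixes X :: "('k, 'x, 'p) module_scheme"
  assumes X: "module R X"
begin

lemma sweedler2_hom_apply:
  assumes "a \<in> carrier A" "x \<in> carrier X"
    and "\<And>y z. y \<in> carrier A \<Longrightarrow> z \<in> carrier A \<Longrightarrow> f y z \<in> carrier (hom_module R X B)"
  shows "sweedler2 (hom_module R X B) \<Delta> f a x = sweedler2 B \<Delta> (\<lambda>y z. f y z x) a"
  by (rule linear_map_sweedler2[OF hom_module_module[OF X B.module_axioms] B.module_axioms
        evaluation_linear[OF assms(2)] assms(1,3)])

lemma sweedler3_hom_apply:
  assumes "a \<in> carrier A" "x \<in> carrier X"
    and "\<And>u y z. u \<in> carrier A \<Longrightarrow> y \<in> carrier A \<Longrightarrow> z \<in> carrier A \<Longrightarrow>
      f u y z \<in> carrier (hom_module R X B)"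
  shows "sweedler3 (hom_module R X B) \<Delta> f a x = sweedler3 B \<Delta> (\<lambda>u y z. f u y z x) a"
  unfolding sweedler3_def
  using assms
  by (simp add: sweedler2_hom_apply sweedler2_closed[OF hom_module_module[OF X B.module_axioms]]
      cong: sweedler2_cong)

abbreviation Hom\<^sub>B :: "('k, 'x \<Rightarrow> 'b) module"
  where "Hom\<^sub>B \<equiv> hom_module R X B"

lemma conv_eval1:
  assumes "bilinear_map R A Hom\<^sub>B Hom\<^sub>B T" "\<phi> \<in> carrier Hom\<^sub>B" "a \<in> carrier A"
  shows "conv Hom\<^sub>B T (conv_point Hom\<^sub>B \<phi>) a x = T a \<phi> x"
  by (simp add: conv_conv_point[OF hom_module_module[OF X B.module_axioms] assms])

lemma conv_eval2:
  assumes T: "bilinear_map R A Hom\<^sub>B Hom\<^sub>B T" and U: "bilinear_map R A Hom\<^sub>B Hom\<^sub>B U"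
    and \<phi>: "\<phi> \<in> carrier Hom\<^sub>B" and a: "a \<in> carrier A" and x: "x \<in> carrier X"
  shows "conv Hom\<^sub>B T (conv Hom\<^sub>B U (conv_point Hom\<^sub>B \<phi>)) a x =
    sweedler2 B \<Delta> (\<lambda>y z. T y (U z \<phi>) x) a"
  unfolding conv_conv_point2[OF hom_module_module[OF X B.module_axioms] T U \<phi> a]
  by (intro sweedler2_hom_apply a x bilinear_map_closed[OF T] bilinear_map_closed[OF U] \<phi>)

lemma conv_eval3:
  assumes T: "bilinear_map R A Hom\<^sub>B Hom\<^sub>B T" and U: "bilinear_map R A Hom\<^sub>B Hom\<^sub>B U"
    and W: "bilinear_map R A Hom\<^sub>B Hom\<^sub>B W"
    and \<phi>: "\<phi> \<in> carrier Hom\<^sub>B" and a: "a \<in> carrier A" and x: "x \<in> carrier X"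
  shows "conv Hom\<^sub>B T (conv Hom\<^sub>B U (conv Hom\<^sub>B W (conv_point Hom\<^sub>B \<phi>))) a x =
    sweedler3 B \<Delta> (\<lambda>u y z. T u (U y (W z \<phi>)) x) a"
  unfolding conv_conv_point3[OF hom_module_module[OF X B.module_axioms] T U W \<phi> a]
  by (intro sweedler3_hom_apply a x bilinear_map_closed[OF T] bilinear_map_closed[OF U]
      bilinear_map_closed[OF W] \<phi>)

end

text \<open>On the linear maps \<open>M \<rightarrow> B\<close>, let \<open>N\<close> be the operator of precomposition with the action. For
  the inclusion the hypothesis reads \<open>R I = L N\<^sup>-\<^sup>1 I\<close>, and solving it for \<open>N I\<close> gives the adjoint action.
  Working with operators avoids the coproduct of \<open>S a\<close>, which a direct substitution of the hypothesis
  into the right-hand side would require.\<close>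

lemma action_eq_conjugation:
  assumes M: "algebra_module R A M act" and contains: "module_contained R M B"
    and rel: "\<And>m a. m \<in> carrier M \<Longrightarrow> a \<in> carrier A \<Longrightarrow>
      m \<otimes>\<^bsub>B\<^esub> a = sweedler2 B \<Delta> (\<lambda>x y. x \<otimes>\<^bsub>B\<^esub> act (S y) m) a"
    and a: "a \<in> carrier A" and m: "m \<in> carrier M"
  shows "act a m = sweedler2 B \<Delta> (\<lambda>x y. x \<otimes>\<^bsub>B\<^esub> (m \<otimes>\<^bsub>B\<^esub> S y)) a"
proof -
  interpret M: algebra_module R A M act by (rule M)
  note Mm = M.V.module_axioms
  let ?H = "hom_module R M B"
  note H = hom_module_module[OF Mm B.module_axioms]
  let ?l = "left_mult_map M B" and ?r = "right_mult_map M B" and ?n = "precompose M act"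
  note act = left_mult_map_action[OF Mm] right_mult_map_action[OF Mm] precompose_action[OF Mm M]
  note comm = right_left_commuting[OF Mm] precompose_commuting[OF Mm M]
  note bil = act[THEN one_sided_action_bilinear]
  note bilS = bil[THEN bilinear_antipode]
  let ?i = "\<lambda>m\<in>carrier M. m"
  have i: "?i \<in> carrier ?H"
    by (rule restrict_hom_module[OF Mm module_contained_inclusion[OF contains]])
  note K = conv_point_closed[OF H i]
  have eq: "conv ?H ?r (conv_point ?H ?i) = conv ?H ?l (conv ?H (\<lambda>x. ?n (S x)) (conv_point ?H ?i))"
  proof (rule conv_space_eqI)
    show left: "conv ?H ?r (conv_point ?H ?i) \<in> conv_space ?H"
      and right: "conv ?H ?l (conv ?H (\<lambda>x. ?n (S x)) (conv_point ?H ?i)) \<in> conv_space ?H"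
      by (intro conv_closed[OF H] bil bilS K)+
    fix a assume a: "a \<in> carrier A"
    show "conv ?H ?r (conv_point ?H ?i) a = conv ?H ?l (conv ?H (\<lambda>x. ?n (S x)) (conv_point ?H ?i)) a"
    proof (rule hom_module_eqI[OF conv_space_closed[OF left a] conv_space_closed[OF right a]])
      fix m assume m: "m \<in> carrier M"
      show "conv ?H ?r (conv_point ?H ?i) a m =
          conv ?H ?l (conv ?H (\<lambda>x. ?n (S x)) (conv_point ?H ?i)) a m"
        unfolding conv_eval1[OF Mm bil(2) i a] conv_eval2[OF Mm bil(1) bilS(3) i a m]
        using a m
        by (auto simp: right_mult_map_def left_mult_map_def precompose_def rel antipode_closed M.act_closed
            intro!: sweedler2_cong)
    qed
  qed
  have "act a m = conv ?H ?n (conv_point ?H ?i) a m"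
    unfolding conv_eval1[OF Mm bil(3) i a] using a m by (simp add: precompose_def M.act_closed)
  also have "\<dots> = conv ?H ?l (conv ?H (\<lambda>x. ?r (S x)) (conv_point ?H ?i)) a m"
    by (simp only: conv_exchange_inverse[OF H act comm K eq])
  also have "\<dots> = sweedler2 B \<Delta> (\<lambda>x y. x \<otimes>\<^bsub>B\<^esub> (m \<otimes>\<^bsub>B\<^esub> S y)) a"
    unfolding conv_eval2[OF Mm bil(1) bilS(2) i a m]
    using a m by (auto simp: right_mult_map_def left_mult_map_def intro!: sweedler2_cong)
  finally show ?thesis .
qed

text \<open>The form of the theorem for an arbitrary bilinear \<open>k : V \<times> V \<rightarrow> B\<close>, with the adjoint action in place
  of the action on \<open>M\<close>. Each condition is the evaluation on pure tensors of an equation between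
  operators applied to \<open>K\<close>.\<close>

lemma bilinear_equivalences:
  assumes V: "algebra_module R A V act" and k: "bilinear_map R V V B k"
  defines "conjugation \<equiv> \<forall>a\<in>carrier A. \<forall>v\<in>carrier V. \<forall>w\<in>carrier V.
      sweedler2 B \<Delta> (\<lambda>x y. x \<otimes>\<^bsub>B\<^esub> (k v w \<otimes>\<^bsub>B\<^esub> S y)) a = sweedler2 B \<Delta> (\<lambda>x y. k (act x v) (act y w)) a"
    and "yetter_drinfeld \<equiv> \<forall>a\<in>carrier A. \<forall>v\<in>carrier V. \<forall>w\<in>carrier V.
      sweedler2 B \<Delta> (\<lambda>x y. k (act x v) w \<otimes>\<^bsub>B\<^esub> y) a = sweedler2 B \<Delta> (\<lambda>x y. x \<otimes>\<^bsub>B\<^esub> k v (act (S y) w)) a"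
    and "compatible \<equiv> \<forall>a\<in>carrier A. \<forall>v\<in>carrier V. \<forall>w\<in>carrier V.
      a \<otimes>\<^bsub>B\<^esub> k v w = sweedler3 B \<Delta> (\<lambda>x y z. k (act x v) (act y w) \<otimes>\<^bsub>B\<^esub> z) a"
    and "right_compatible \<equiv> \<forall>a\<in>carrier A. \<forall>v\<in>carrier V. \<forall>w\<in>carrier V.
      k v w \<otimes>\<^bsub>B\<^esub> a = sweedler3 B \<Delta> (\<lambda>x y z. x \<otimes>\<^bsub>B\<^esub> k (act (S y) v) (act (S z) w)) a"
    and "commutes \<equiv> \<forall>a\<in>carrier A. \<forall>v\<in>carrier V. \<forall>w\<in>carrier V. a \<otimes>\<^bsub>B\<^esub> k v w = k v w \<otimes>\<^bsub>B\<^esub> a"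
  shows "conjugation \<longleftrightarrow> compatible" and "yetter_drinfeld \<longleftrightarrow> compatible"
    and "right_compatible \<longleftrightarrow> compatible"
    and "(\<forall>a\<in>carrier A. \<forall>v\<in>carrier V. \<forall>w\<in>carrier V. k (act a v) w = k v (act (S a) w)) \<Longrightarrow>
      commutes \<longleftrightarrow> compatible"
proof -
  interpret V: algebra_module R A V act by (rule V)
  note Vm = V.V.module_axioms
  interpret VV: module_pair R V V by (intro module_pair.intro Vm)
  let ?X = "tensor R V V"
  note X = VV.tensor_module
  let ?H = "hom_module R ?X B"
  note H = hom_module_module[OF X B.module_axioms]
  let ?l = "left_mult_map ?X B" and ?r = "right_mult_map ?X B"
  let ?p = "precompose ?X (act_fst R V V act)" and ?q = "precompose ?X (act_snd R V V act)"
  note fst = act_fst_module[OF V Vm] and snd = act_snd_module[OF Vm V]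
  note act = left_mult_map_action[OF X] right_mult_map_action[OF X]
    precompose_action[OF X fst] precompose_action[OF X snd]
  note closed_fst = algebra_module.act_closed[OF fst] and closed_snd = algebra_module.act_closed[OF snd]
  have "commuting ?H ?p ?q"
    unfolding commuting_def precompose_def
    by (auto intro!: restrict_ext simp: closed_fst closed_snd act_fst_act_snd_commute[OF V V])
  note comm = right_left_commuting[OF X] precompose_commuting(1)[OF X fst] precompose_commuting(1)[OF X snd]
    precompose_commuting(2)[OF X fst] precompose_commuting(2)[OF X snd] this
  note bil = act[THEN one_sided_action_bilinear]
  note bilS = bil[THEN bilinear_antipode]
  define \<phi> where "\<phi> = restrict (tensor_lift B k) (carrier ?X)"
  have \<phi>: "\<phi> \<in> carrier ?H"
    unfolding \<phi>_def
    by (rule restrict_hom_module[OF X VV.tensor_lift_linear[OF B.module_axioms k]])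
  have \<phi>_pure: "\<phi> (pure_tensor R V V v w) = k v w" if "v \<in> carrier V" "w \<in> carrier V" for v w
    using VV.tensor_lift_pure[OF B.module_axioms k that] VV.pure_tensor_closed[OF that]
    by (simp add: \<phi>_def)
  define K where "K = conv_point ?H \<phi>"
  have K: "K \<in> conv_space ?H" unfolding K_def by (rule conv_point_closed[OF H \<phi>])
  \<comment> \<open>Equations between operators are the universally quantified identities of the conditions.\<close>
  have ext: "\<Phi> = \<Psi> \<longleftrightarrow> (\<forall>a\<in>carrier A. \<forall>v\<in>carrier V. \<forall>w\<in>carrier V.
      \<Phi> a (pure_tensor R V V v w) = \<Psi> a (pure_tensor R V V v w))"
    if "\<Phi> \<in> conv_space ?H" "\<Psi> \<in> conv_space ?H" for \<Phi> \<Psi>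
  proof
    assume eq: "\<forall>a\<in>carrier A. \<forall>v\<in>carrier V. \<forall>w\<in>carrier V.
      \<Phi> a (pure_tensor R V V v w) = \<Psi> a (pure_tensor R V V v w)"
    show "\<Phi> = \<Psi>"
    proof (rule conv_space_eqI[OF that])
      fix a assume a: "a \<in> carrier A"
      note c = conv_space_closed[OF that(1) a] conv_space_closed[OF that(2) a]
      show "\<Phi> a = \<Psi> a"
        by (rule hom_module_eqI[OF c], rule VV.tensor_linear_eqI[OF B.module_axioms c[THEN hom_module_linear]])
          (use eq a in auto)
    qed
  qed simp
  note closed = act[THEN conv_action_closed(1)[OF H]] act[THEN conv_action_closed(2)[OF H]] K
  note defs = left_mult_map_def right_mult_map_def precompose_def
  note pure = act_fst_pure[OF V Vm] act_snd_pure[OF Vm V] VV.pure_tensor_closed \<phi>_pure V.act_closed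
    antipode_closed closed_fst closed_snd
  note eval1 = conv_eval1[OF X _ \<phi>, folded K_def]
    and eval2 = conv_eval2[OF X _ _ \<phi>, folded K_def]
    and eval3 = conv_eval3[OF X _ _ _ \<phi>, folded K_def]
  note solve = conv_equation_equivalences[OF H act comm K]
  let ?L = "conv ?H ?l" and ?R = "conv ?H ?r" and ?P = "conv ?H ?p" and ?Q = "conv ?H ?q"
  let ?R' = "conv ?H (\<lambda>x. ?r (S x))" and ?P' = "conv ?H (\<lambda>x. ?p (S x))"
    and ?Q' = "conv ?H (\<lambda>x. ?q (S x))"
  \<comment> \<open>Each fact is named after the operators that it evaluates; a prime marks the antipode.\<close>
  have L: "?L K a (pure_tensor R V V v w) = a \<otimes>\<^bsub>B\<^esub> k v w"
    if "a \<in> carrier A" "v \<in> carrier V" "w \<in> carrier V" for a v w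
    unfolding eval1[OF bil(1) that(1)]
    by (simp add: defs pure that)
  have R: "?R K a (pure_tensor R V V v w) = k v w \<otimes>\<^bsub>B\<^esub> a"
    if "a \<in> carrier A" "v \<in> carrier V" "w \<in> carrier V" for a v w
    unfolding eval1[OF bil(2) that(1)]
    by (simp add: defs pure that)
  have P: "?P K a (pure_tensor R V V v w) = k (act a v) w"
    if "a \<in> carrier A" "v \<in> carrier V" "w \<in> carrier V" for a v w
    unfolding eval1[OF bil(3) that(1)]
    by (simp add: defs pure that)
  have Q': "?Q' K a (pure_tensor R V V v w) = k v (act (S a) w)"
    if "a \<in> carrier A" "v \<in> carrier V" "w \<in> carrier V" for a v w
    unfolding eval1[OF bilS(4) that(1)]
    by (simp add: defs pure that)
  have LR': "?L (?R' K) a (pure_tensor R V V v w) = sweedler2 B \<Delta> (\<lambda>x y. x \<otimes>\<^bsub>B\<^esub> (k v w \<otimes>\<^bsub>B\<^esub> S y)) a"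
    if "a \<in> carrier A" "v \<in> carrier V" "w \<in> carrier V" for a v w
    unfolding eval2[OF bil(1) bilS(2) that(1) VV.pure_tensor_closed[OF that(2,3)]]
    by (intro sweedler2_cong that) (simp_all add: defs pure that)
  have PQ: "?P (?Q K) a (pure_tensor R V V v w) = sweedler2 B \<Delta> (\<lambda>x y. k (act x v) (act y w)) a"
    if "a \<in> carrier A" "v \<in> carrier V" "w \<in> carrier V" for a v w
    unfolding eval2[OF bil(3,4) that(1) VV.pure_tensor_closed[OF that(2,3)]]
    by (intro sweedler2_cong that) (simp_all add: defs pure that)
  have PR: "?P (?R K) a (pure_tensor R V V v w) = sweedler2 B \<Delta> (\<lambda>x y. k (act x v) w \<otimes>\<^bsub>B\<^esub> y) a"
    if "a \<in> carrier A" "v \<in> carrier V" "w \<in> carrier V" for a v w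
    unfolding eval2[OF bil(3,2) that(1) VV.pure_tensor_closed[OF that(2,3)]]
    by (intro sweedler2_cong that) (simp_all add: defs pure that)
  have LQ': "?L (?Q' K) a (pure_tensor R V V v w) = sweedler2 B \<Delta> (\<lambda>x y. x \<otimes>\<^bsub>B\<^esub> k v (act (S y) w)) a"
    if "a \<in> carrier A" "v \<in> carrier V" "w \<in> carrier V" for a v w
    unfolding eval2[OF bil(1) bilS(4) that(1) VV.pure_tensor_closed[OF that(2,3)]]
    by (intro sweedler2_cong that) (simp_all add: defs pure that)
  have PQR: "?P (?Q (?R K)) a (pure_tensor R V V v w) = sweedler3 B \<Delta> (\<lambda>x y z. k (act x v) (act y w) \<otimes>\<^bsub>B\<^esub> z) a"
    if "a \<in> carrier A" "v \<in> carrier V" "w \<in> carrier V" for a v w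
    unfolding eval3[OF bil(3,4,2) that(1) VV.pure_tensor_closed[OF that(2,3)]]
    by (intro sweedler3_cong that) (simp_all add: defs pure that)
  have LP'Q': "?L (?P' (?Q' K)) a (pure_tensor R V V v w) = sweedler3 B \<Delta> (\<lambda>x y z. x \<otimes>\<^bsub>B\<^esub> k (act (S y) v) (act (S z) w)) a"
    if "a \<in> carrier A" "v \<in> carrier V" "w \<in> carrier V" for a v w
    unfolding eval3[OF bil(1) bilS(3,4) that(1) VV.pure_tensor_closed[OF that(2,3)]]
    by (intro sweedler3_cong that) (simp_all add: defs pure that)
  have conj: "conjugation \<longleftrightarrow> ?L (?R' K) = ?P (?Q K)"
    by (simp add: ext closed conjugation_def LR' PQ)
  have comp: "compatible \<longleftrightarrow> ?L K = ?P (?Q (?R K))"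
    by (simp add: ext closed compatible_def L PQR)
  have yd: "yetter_drinfeld \<longleftrightarrow> ?P (?R K) = ?L (?Q' K)"
    by (simp add: ext closed yetter_drinfeld_def PR LQ')
  have rc: "right_compatible \<longleftrightarrow> ?R K = ?L (?P' (?Q' K))"
    by (simp add: ext closed right_compatible_def R LP'Q')
  have cm: "commutes \<longleftrightarrow> ?L K = ?R K"
    by (simp add: ext closed commutes_def L R)
  show "conjugation \<longleftrightarrow> compatible" "yetter_drinfeld \<longleftrightarrow> compatible"
    "right_compatible \<longleftrightarrow> compatible"
    unfolding conj comp yd rc by (rule solve)+
  assume skew: "\<forall>a\<in>carrier A. \<forall>v\<in>carrier V. \<forall>w\<in>carrier V. k (act a v) w = k v (act (S a) w)"
  have "?P K = ?Q' K"
    by (simp add: ext closed P Q' skew)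
  then show "commutes \<longleftrightarrow> compatible"
    unfolding cm comp by (rule solve)
qed

end

section \<open>Exterior squares\<close>

lemma submodule_span_superset: "E \<subseteq> submodule_span R X E"
  by (auto simp: submodule_span_def)

lemma submodule_span_minimal: "submodule H R X \<Longrightarrow> E \<subseteq> H \<Longrightarrow> submodule_span R X E \<subseteq> H"
  by (auto simp: submodule_span_def)

lemma submodule_span_submodule:
  assumes "module R X" "E \<subseteq> carrier X"
  shows "submodule (submodule_span R X E) R X"
proof -
  interpret X: module R X by fact
  note E = X.submoduleE
  show ?thesis
  proof (rule X.submoduleI)
    show "submodule_span R X E \<subseteq> carrier X"
      by (rule submodule_span_minimal[OF X.carrier_is_submodule assms(2)])
    show "\<zero>\<^bsub>X\<^esub> \<in> submodule_span R X E"
      unfolding submodule_span_def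
    proof clarify
      fix H assume H: "submodule H R X"
      then interpret H: submodule H R X .
      show "\<zero>\<^bsub>X\<^esub> \<in> H" using H.one_closed by simp
    qed
  qed (auto simp: submodule_span_def E)
qed

lemma wedge_bilinear:
  assumes "module R V"
  shows "bilinear_map R V V (wedge_module R V) (wedge R V)"
proof -
  interpret V: module R V by fact
  interpret module_pair R V V by (intro module_pair.intro assms)
  interpret T: module R "tensor R V V" by (rule tensor_module)
  let ?p = "pure_tensor R V V"
  have closed: "wedge R V v w \<in> carrier (wedge_module R V)" if "v \<in> carrier V" "w \<in> carrier V" for v w
    using that submodule_span_superset[of "{wedge R V v w | v w. v \<in> carrier V \<and> w \<in> carrier V}" R "tensor R V V"]
    by (auto simp: wedge_module_def)
  note l = bilinear_map_left[OF pure_tensor_bilinear] and r = bilinear_map_right[OF pure_tensor_bilinear]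
  note add = l[THEN linear_maps_add] r[THEN linear_maps_add]
    and smult = l[THEN linear_maps_smult] r[THEN linear_maps_smult]
  have [simp]: "add (wedge_module R V) = add (tensor R V V)" "smult (wedge_module R V) = smult (tensor R V V)"
    by (simp_all add: wedge_module_def)
  have "(p \<oplus>\<^bsub>tensor R V V\<^esub> p') \<ominus>\<^bsub>tensor R V V\<^esub> (q \<oplus>\<^bsub>tensor R V V\<^esub> q') =
      (p \<ominus>\<^bsub>tensor R V V\<^esub> q) \<oplus>\<^bsub>tensor R V V\<^esub> (p' \<ominus>\<^bsub>tensor R V V\<^esub> q')"
    if "p \<in> carrier (tensor R V V)" "p' \<in> carrier (tensor R V V)"
      "q \<in> carrier (tensor R V V)" "q' \<in> carrier (tensor R V V)" for p p' q q'
    using that by (simp add: a_minus_def T.minus_add T.a_ac)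
  moreover have "(r \<odot>\<^bsub>tensor R V V\<^esub> p) \<ominus>\<^bsub>tensor R V V\<^esub> (r \<odot>\<^bsub>tensor R V V\<^esub> q) =
      r \<odot>\<^bsub>tensor R V V\<^esub> (p \<ominus>\<^bsub>tensor R V V\<^esub> q)"
    if "r \<in> carrier R" "p \<in> carrier (tensor R V V)" "q \<in> carrier (tensor R V V)" for r p q
    using that by (simp add: a_minus_def T.smult_r_distr T.smult_r_minus)
  ultimately show ?thesis
    by (intro bilinear_mapI linear_mapsI closed) (simp_all add: wedge_def add smult pure_tensor_closed)
qed

section \<open>The braiding and the ambient multiplication\<close>

context hopf_algebra_in
begin

text \<open>The map \<open>m \<otimes> a \<mapsto> \<mu>\<^sub>B (\<tau>\<^sup>o\<^sup>p (m \<otimes> a))\<close> is linear, hence passes through the Sweedler sum in the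
  Yetter--Drinfeld condition, whose left side thereby becomes a sum of products \<open>\<kappa>(a\<^sub>1(v), v') a\<^sub>2\<close>.\<close>

lemma mult_tau_op:
  assumes M: "algebra_module R A M act" and contains: "module_contained R M B"
  shows mult_tau_op_pure: "\<lbrakk>m \<in> carrier M; a \<in> carrier A\<rbrakk> \<Longrightarrow>
      mult_map B (tau_op R A \<Delta> S M act (pure_tensor R M A m a)) =
      sweedler2 B \<Delta> (\<lambda>x y. x \<otimes>\<^bsub>B\<^esub> act (S y) m) a"
    and "(\<lambda>t. mult_map B (tau_op R A \<Delta> S M act t)) \<in> linear_maps R (tensor R M A) B"
proof -
  interpret M: algebra_module R A M act by (rule M)
  interpret AM: module_pair R A M by (intro module_pair.intro A_module M.V.module_axioms)
  interpret MA: module_pair R M A by (intro module_pair.intro A_module M.V.module_axioms)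
  let ?T = "tensor R A M"
  note T = AM.tensor_module
  have mult: "bilinear_map R A M B (\<lambda>x m. x \<otimes>\<^bsub>B\<^esub> m)"
    by (rule bilinear_map_compose[OF B.mult_bilinear A_inclusion module_contained_inclusion[OF contains]])
  have mult_lin: "mult_map B \<in> linear_maps R ?T B"
    using AM.tensor_lift_linear[OF B.module_axioms mult] by (simp add: mult_map_def[abs_def])
  let ?G = "\<lambda>m a. sweedler2 ?T \<Delta> (\<lambda>x y. pure_tensor R A M x (act (S y) m)) a"
  note actS = linear_maps_compose[OF antipode_linear bilinear_map_left[OF M.act_bilinear]]
  have bil: "bilinear_map R A A ?T (\<lambda>x y. pure_tensor R A M x (act (S y) m))" if "m \<in> carrier M" for m
    by (rule bilinear_map_compose[OF AM.pure_tensor_bilinear linear_maps_id actS[OF that]])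
  have G: "bilinear_map R M A ?T ?G"
  proof (rule bilinear_mapI)
    show "(\<lambda>m. ?G m a) \<in> linear_maps R M ?T" if "a \<in> carrier A" for a
      by (rule sweedler2_parameter_linear[OF T that])
        (intro linear_maps_compose[OF M.act_linear] bilinear_map_right[OF AM.pure_tensor_bilinear] antipode_closed)
  qed (rule sweedler2_linear[OF T bil])
  show "(\<lambda>t. mult_map B (tau_op R A \<Delta> S M act t)) \<in> linear_maps R (tensor R M A) B"
    unfolding tau_op_def
    by (rule linear_maps_compose[OF MA.tensor_lift_linear[OF T G] mult_lin])
  assume m: "m \<in> carrier M" and a: "a \<in> carrier A"
  have "mult_map B (tau_op R A \<Delta> S M act (pure_tensor R M A m a)) = mult_map B (?G m a)"
    unfolding tau_op_def by (simp add: MA.tensor_lift_pure[OF T G m a])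
  also have "\<dots> = sweedler2 B \<Delta> (\<lambda>x y. mult_map B (pure_tensor R A M x (act (S y) m))) a"
    by (rule linear_map_sweedler2[OF T B.module_axioms mult_lin a bilinear_map_closed[OF bil[OF m]]])
  also have "\<dots> = sweedler2 B \<Delta> (\<lambda>x y. x \<otimes>\<^bsub>B\<^esub> act (S y) m) a"
    using m
    by (intro sweedler2_cong[OF a])
      (simp add: mult_map_def AM.tensor_lift_pure[OF B.module_axioms mult] M.act_closed antipode_closed)
  finally show "mult_map B (tau_op R A \<Delta> S M act (pure_tensor R M A m a)) =
      sweedler2 B \<Delta> (\<lambda>x y. x \<otimes>\<^bsub>B\<^esub> act (S y) m) a" .
qed

end

text \<open>The elements of the exterior square whose image commutes with \<open>a\<close> form a submodule.\<close>

lemma (in assoc_algebra) commutant_of_wedges: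
  assumes V: "module R V" and h: "h \<in> linear_maps R (wedge_module R V) A" and a: "a \<in> carrier A"
    and comm: "\<And>v w. v \<in> carrier V \<Longrightarrow> w \<in> carrier V \<Longrightarrow>
      a \<otimes>\<^bsub>A\<^esub> h (wedge R V v w) = h (wedge R V v w) \<otimes>\<^bsub>A\<^esub> a"
    and t: "t \<in> carrier (wedge_module R V)"
  shows "a \<otimes>\<^bsub>A\<^esub> h t = h t \<otimes>\<^bsub>A\<^esub> a"
proof -
  interpret V: module R V by (rule V)
  interpret module_pair R V V by (intro module_pair.intro V)
  interpret T: module R "tensor R V V" by (rule tensor_module)
  let ?T = "tensor R V V" and ?W = "wedge_module R V"
  let ?E = "{wedge R V v w | v w. v \<in> carrier V \<and> w \<in> carrier V}"
  have W: "carrier ?W = submodule_span R ?T ?E" and ops: "add ?W = add ?T" "smult ?W = smult ?T"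
    by (simp_all add: wedge_module_def)
  have "?E \<subseteq> carrier ?T" by (auto simp: wedge_def pure_tensor_closed)
  note span = submodule_span_submodule[OF tensor_module this, folded W]
  note E = T.submoduleE[OF span]
  let ?C = "{t \<in> carrier ?W. a \<otimes>\<^bsub>A\<^esub> h t = h t \<otimes>\<^bsub>A\<^esub> a}"
  note hc = linear_maps_closed[OF h] and ha = linear_maps_add[OF h, unfolded ops]
    and hs = linear_maps_smult[OF h, unfolded ops]
  have smult: "r \<odot>\<^bsub>?T\<^esub> t \<in> ?C" if "r \<in> carrier R" "t \<in> ?C" for r t
    using that a by (simp add: E hs hc smult_mult_left smult_mult_right)
  have "submodule ?C R ?T"
  proof (rule T.submoduleI)
    show C: "?C \<subseteq> carrier ?T" using E(1) by auto
    obtain t where "t \<in> carrier ?W" using E(2) by auto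
    then have z: "\<zero>\<^bsub>?T\<^esub> \<in> carrier ?W"
      using E(4)[of "\<zero>\<^bsub>R\<^esub>" t] E(1) by (auto simp: subset_iff)
    have "h \<zero>\<^bsub>?T\<^esub> = \<zero>\<^bsub>A\<^esub>"
      using hs[of "\<zero>\<^bsub>R\<^esub>" "\<zero>\<^bsub>?T\<^esub>"] z hc[OF z] by simp
    then show "\<zero>\<^bsub>?T\<^esub> \<in> ?C" using z a by simp
    show "\<ominus>\<^bsub>?T\<^esub> t \<in> ?C" if "t \<in> ?C" for t
      using smult[of "\<ominus>\<^bsub>R\<^esub> \<one>\<^bsub>R\<^esub>", OF _ that] that C by (simp add: T.smult_l_minus subset_iff)
    show "t \<oplus>\<^bsub>?T\<^esub> u \<in> ?C" if "t \<in> ?C" "u \<in> ?C" for t u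
      using that a by (simp add: E ha hc l_distr r_distr)
  qed (rule smult)
  moreover have "?E \<subseteq> ?C"
    using comm bilinear_map_closed[OF wedge_bilinear[OF V]] by auto
  ultimately have "submodule_span R ?T ?E \<subseteq> ?C" by (rule submodule_span_minimal)
  then show ?thesis using t by (auto simp: W)
qed

theorem proposition4p6:
  fixes R :: "('k, 'r) ring_scheme"
    and A :: "('k, 'b, 'c) module_scheme"
    and V :: "('k, 'v, 'd) module_scheme"
    and M :: "('k, 'b, 'e) module_scheme"
    and B :: "('k, 'b, 'f) module_scheme"
    and \<Delta> :: "'b \<Rightarrow> ('b \<times> 'b) list set" and \<epsilon> :: "'b \<Rightarrow> 'k" and S :: "'b \<Rightarrow> 'b"
    and actV :: "'b \<Rightarrow> 'v \<Rightarrow> 'v" and actM :: "'b \<Rightarrow> 'b \<Rightarrow> 'b"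
    and \<kappa> :: "('v \<times> 'v) list set \<Rightarrow> 'b"
  assumes hopf: "cocommutative_hopf_algebra R A \<Delta> \<epsilon> S" and freeA: "free_module R A"
    and modV: "algebra_module R A V actV" and freeV: "free_module R V"
    and modM: "algebra_module R A M actM" and freeM: "free_module R M"
    and kappa: "\<kappa> \<in> linear_maps R (wedge_module R V) M"
    and algB: "assoc_algebra R B"
    and containsA: "algebra_contained R A B" and containsM: "module_contained R M B"
    and relB: "\<And>m a. m \<in> carrier M \<Longrightarrow> a \<in> carrier A \<Longrightarrow>
      m \<otimes>\<^bsub>B\<^esub> a = mult_map B (tau_op R A \<Delta> S M actM (pure_tensor R M A m a))"
  defines "equivariant \<equiv>
      \<forall>a\<in>carrier A. \<forall>v\<in>carrier V. \<forall>v'\<in>carrier V.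
        actM a (\<kappa> (wedge R V v v')) =
        sweedler2 M \<Delta> (\<lambda>a\<^sub>1 a\<^sub>2. \<kappa> (wedge R V (actV a\<^sub>1 v) (actV a\<^sub>2 v'))) a"
    and "yetter_drinfeld \<equiv>
      \<forall>a\<in>carrier A. \<forall>v\<in>carrier V. \<forall>v'\<in>carrier V.
        mult_map B (tau_op R A \<Delta> S M actM
          (sweedler2 (tensor R M A) \<Delta>
            (\<lambda>a\<^sub>1 a\<^sub>2. pure_tensor R M A (\<kappa> (wedge R V (actV a\<^sub>1 v) v')) a\<^sub>2) a)) =
        sweedler2 B \<Delta> (\<lambda>a\<^sub>1 a\<^sub>2. a\<^sub>1 \<otimes>\<^bsub>B\<^esub> \<kappa> (wedge R V v (actV (S a\<^sub>2) v'))) a"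
    and "compatible \<equiv>
      \<forall>a\<in>carrier A. \<forall>v\<in>carrier V. \<forall>v'\<in>carrier V.
        a \<otimes>\<^bsub>B\<^esub> \<kappa> (wedge R V v v') =
        sweedler3 B \<Delta> (\<lambda>a\<^sub>1 a\<^sub>2 a\<^sub>3. \<kappa> (wedge R V (actV a\<^sub>1 v) (actV a\<^sub>2 v')) \<otimes>\<^bsub>B\<^esub> a\<^sub>3) a"
    and "right_compatible \<equiv>
      \<forall>a\<in>carrier A. \<forall>v\<in>carrier V. \<forall>v'\<in>carrier V.
        \<kappa> (wedge R V v v') \<otimes>\<^bsub>B\<^esub> a =
        sweedler3 B \<Delta>
          (\<lambda>a\<^sub>1 a\<^sub>2 a\<^sub>3. a\<^sub>1 \<otimes>\<^bsub>B\<^esub> \<kappa> (wedge R V (actV (S a\<^sub>2) v) (actV (S a\<^sub>3) v'))) a"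
    and "image_commutes \<equiv>
      \<forall>m\<in>\<kappa> ` carrier (wedge_module R V). \<forall>a\<in>carrier A. m \<otimes>\<^bsub>B\<^esub> a = a \<otimes>\<^bsub>B\<^esub> m"
  shows "(equivariant \<longleftrightarrow> yetter_drinfeld) \<and> (equivariant \<longleftrightarrow> compatible) \<and>
    (equivariant \<longleftrightarrow> right_compatible) \<and>
    ((\<forall>a\<in>carrier A. \<forall>v\<in>carrier V. \<forall>v'\<in>carrier V.
        \<kappa> (wedge R V (actV a v) v') = \<kappa> (wedge R V v (actV (S a) v'))) \<longrightarrow>
     (equivariant \<longleftrightarrow> image_commutes))"
proof -
  interpret H: cocommutative_hopf_algebra R A \<Delta> \<epsilon> S by (rule hopf)
  interpret B: assoc_algebra R B by (rule algB)
  interpret hopf_algebra_in R A \<Delta> \<epsilon> S B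
    by (intro hopf_algebra_in.intro hopf_algebra_in_axioms.intro hopf algB containsA)
  interpret V: algebra_module R A V actV by (rule modV)
  interpret M: algebra_module R A M actM by (rule modM)
  note Mm = M.V.module_axioms and Vm = V.V.module_axioms
  note incl = module_contained_inclusion[OF containsM]
  define k where "k v w = \<kappa> (wedge R V v w)" for v w
  have kM: "bilinear_map R V V M k"
    using bilinear_map_post[OF wedge_bilinear[OF Vm] kappa] by (simp add: k_def[abs_def])
  have kB: "bilinear_map R V V B k"
    using bilinear_map_post[OF kM incl] .
  note closed = bilinear_map_closed[OF kM] V.act_closed H.antipode_closed
  have rel: "m \<otimes>\<^bsub>B\<^esub> a = sweedler2 B \<Delta> (\<lambda>x y. x \<otimes>\<^bsub>B\<^esub> actM (S y) m) a"
    if "m \<in> carrier M" "a \<in> carrier A" for m a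
    using relB[OF that] mult_tau_op_pure[OF modM containsM that] by simp
  note solve = bilinear_equivalences[OF modV kB]

  \<comment> \<open>The action on the values of \<open>\<kappa>\<close> is the adjoint action, so equivariance becomes an identity in \<open>B\<close>.\<close>
  have equivariant: "equivariant \<longleftrightarrow> (\<forall>a\<in>carrier A. \<forall>v\<in>carrier V. \<forall>w\<in>carrier V.
      sweedler2 B \<Delta> (\<lambda>x y. x \<otimes>\<^bsub>B\<^esub> (k v w \<otimes>\<^bsub>B\<^esub> S y)) a =
      sweedler2 B \<Delta> (\<lambda>x y. k (actV x v) (actV y w)) a)"
  proof -
    have "actM a (k v w) = sweedler2 B \<Delta> (\<lambda>x y. x \<otimes>\<^bsub>B\<^esub> (k v w \<otimes>\<^bsub>B\<^esub> S y)) a"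
      if "a \<in> carrier A" "v \<in> carrier V" "w \<in> carrier V" for a v w
      by (rule action_eq_conjugation[OF modM containsM rel]) (use that closed in auto)
    moreover have "sweedler2 M \<Delta> (\<lambda>x y. k (actV x v) (actV y w)) a =
        sweedler2 B \<Delta> (\<lambda>x y. k (actV x v) (actV y w)) a"
      if "a \<in> carrier A" "v \<in> carrier V" "w \<in> carrier V" for a v w
      by (rule H.linear_map_sweedler2[OF Mm B.module_axioms incl]) (use that closed in auto)
    ultimately show ?thesis
      unfolding equivariant_def k_def[symmetric] by simp
  qed

  have yetter_drinfeld: "yetter_drinfeld \<longleftrightarrow> (\<forall>a\<in>carrier A. \<forall>v\<in>carrier V. \<forall>w\<in>carrier V.
      sweedler2 B \<Delta> (\<lambda>x y. k (actV x v) w \<otimes>\<^bsub>B\<^esub> y) a =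
      sweedler2 B \<Delta> (\<lambda>x y. x \<otimes>\<^bsub>B\<^esub> k v (actV (S y) w)) a)"
  proof -
    interpret MA: module_pair R M A by (intro module_pair.intro H.A_module Mm)
    have "mult_map B (tau_op R A \<Delta> S M actM
        (sweedler2 (tensor R M A) \<Delta> (\<lambda>x y. pure_tensor R M A (k (actV x v) w) y) a)) =
        sweedler2 B \<Delta> (\<lambda>x y. mult_map B (tau_op R A \<Delta> S M actM (pure_tensor R M A (k (actV x v) w) y))) a"
      if "a \<in> carrier A" "v \<in> carrier V" "w \<in> carrier V" for a v w
      by (rule H.linear_map_sweedler2[OF MA.tensor_module B.module_axioms mult_tau_op(2)[OF modM containsM]])
        (use that closed in \<open>auto intro: MA.pure_tensor_closed\<close>)
    moreover have "sweedler2 B \<Delta> (\<lambda>x y. mult_map B (tau_op R A \<Delta> S M actM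
        (pure_tensor R M A (k (actV x v) w) y))) a = sweedler2 B \<Delta> (\<lambda>x y. k (actV x v) w \<otimes>\<^bsub>B\<^esub> y) a"
      if "a \<in> carrier A" "v \<in> carrier V" "w \<in> carrier V" for a v w
      using that by (intro H.sweedler2_cong) (auto simp: relB closed)
    ultimately show ?thesis
      unfolding yetter_drinfeld_def k_def[symmetric] by simp
  qed

  have image_commutes: "image_commutes \<longleftrightarrow> (\<forall>a\<in>carrier A. \<forall>v\<in>carrier V. \<forall>w\<in>carrier V.
      a \<otimes>\<^bsub>B\<^esub> k v w = k v w \<otimes>\<^bsub>B\<^esub> a)" (is "_ \<longleftrightarrow> ?comm")
  proof
    assume image_commutes
    then show ?comm
      unfolding image_commutes_def k_def using bilinear_map_closed[OF wedge_bilinear[OF Vm]] by auto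
  next
    assume comm: ?comm
    have "a \<otimes>\<^bsub>B\<^esub> \<kappa> t = \<kappa> t \<otimes>\<^bsub>B\<^esub> a" if "a \<in> carrier A" "t \<in> carrier (wedge_module R V)" for a t
      by (rule B.commutant_of_wedges[OF Vm linear_maps_compose[OF kappa incl]])
        (use that comm A_in_B in \<open>auto simp: k_def\<close>)
    then show image_commutes unfolding image_commutes_def by auto
  qed

  have "(equivariant \<longleftrightarrow> compatible)" "(yetter_drinfeld \<longleftrightarrow> compatible)" "(right_compatible \<longleftrightarrow> compatible)"
    unfolding equivariant yetter_drinfeld compatible_def right_compatible_def k_def[symmetric]
    by (rule solve)+
  moreover have "image_commutes \<longleftrightarrow> compatible"
    if "\<forall>a\<in>carrier A. \<forall>v\<in>carrier V. \<forall>v'\<in>carrier V.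
        \<kappa> (wedge R V (actV a v) v') = \<kappa> (wedge R V v (actV (S a) v'))"
    using that unfolding image_commutes compatible_def k_def[symmetric] by (rule solve(4))
  ultimately show ?thesis by blast
qed

end
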